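(* Let $G$ be a finite directed graph with vertex set $\mathcal V$ and adjacency matrix $A_G$. The zeta function of the Markov-Dyck shift $D_G$ is $$\zeta_{D_G}(z)=\frac{1}{\det\big((I-D(A_G,z)-A_G z)(I-D^*(A_G,z)A_G z)\big)}=\frac{\det(D^*(A_G,z))}{\big(\det(I-D^*(A_G,z)A_G z)\big)^2}.$$
   Context: Let $G$ be a finite directed graph with vertex set $\mathcal V$ and edge set $\mathcal E$; $s(e)$ and $r(e)$ are the initial and final vertex of $e\in\mathcal E$; $A_G(u,v)$ is the number of edges from $u$ to $v$. Take two copies $\mathcal E^-=\{e^-:e\in\mathcal E\}$ and $\mathcal E^+=\{e^+:e\in\mathcal E\}$, where $e^-$ goes from $s(e)$ to $r(e)$ and $e^+$ goes from $r(e)$ to $s(e)$. The graph inverse semigroup of $G$ is the semigroup with zero generated by $\mathcal E^-\cup\{P_v:v\in\mathcal V\}\cup\mathcal E^+$ with relations $P_u^2=P_u$, $P_uP_w=0$ for $u\neq w$; $P_{s(e)}e^-=e^-=e^-P_{r(e)}$ and $P_{r(e)}e^+=e^+=e^+P_{s(e)}$; $f^-f^+=P_{s(f)}$ and $f^-g^+=0$ for $f\ne g$; consequently $g^+f^-=0$ if $s(f)\neq s(g)$, $f^-g^-=0$ if $r(f)\ne s(g)$, and $f^+g^+=0$ if $s(f)\neq r(g)$. The Markov-Dyck shift $D_G$ is the subshift over the alphabet $\mathcal E^-\cup\mathcal E^+$ whose admissible words are exactly the words $(e_k)_{1\le k\le K}$ with $\prod_{1\le k\le K}e_k\neq 0$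 in this semigroup. For a subshift $X$, $\Pi_n(X)$ is the number of points $x \in X$ of period $n$ (points fixed by the $n$-th power of the shift), and $\zeta_X(z)=\exp\big(\sum_{n\ge1}\Pi_n(X)z^n/n\big)$. For $v\in\mathcal V$ the Markov-Dyck code $\mathcal C_v$ is the set of nonempty words $(c_k)_{1\le k\le K}$ over $\mathcal E^-\cup\mathcal E^+$ with $\prod_{1\le k\le K}c_k=P_v$ and $\prod_{1\le j\le J}c_j\neq P_v$ for $1\le J<K$. For a set $\mathcal L$ of words, $g_{\mathcal L}(z)=\sum_{n\ge0}\#\{w\in\mathcal L:\ell(w)=n\}z^n$, where $\ell(w)$ is the length of $w$. $D(A_G,z)$ is the diagonal matrix with entries $g_{\mathcal C_v}(z)$, $v\in\mathcal V$, and $D^*(A_G,z)$ is the diagonal matrix with entries $\frac{1}{1-g_{\mathcal C_v}(z)}$, $v\in\mathcal V$. The identity is one of power series in $z$. *)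

theory Defs
  imports
    "HOL-Computational_Algebra.Formal_Power_Series"
    "Graph_Theory.Digraph"
    "Jordan_Normal_Form.Determinant"
begin

text \<open>
  Graphs are finite directed multigraphs \<open>G\<close> with initial vertex \<open>tail G e\<close> and final vertex
  \<open>head G e\<close> of an arc \<open>e\<close>.
\<close>

subsection \<open>The graph inverse semigroup\<close>

text \<open>
  Generators \<open>Neg e\<close>, \<open>Vert v\<close>, \<open>Pos e\<close> stand for $e^-$, $P_v$, $e^+$.  A semigroup with zero
  given by generators and relations is the semigroup presented by the generators, one more
  generator \<open>Zero\<close>, and the additional relations making \<open>Zero\<close> absorbing.
\<close>

datatype ('v, 'e) gen = Zero | Vert 'v | Neg 'e | Pos 'e

definition gens :: "('v, 'e) pre_digraph \<Rightarrow> ('v, 'e) gen set" where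
  "gens G = {Zero} \<union> Vert ` verts G \<union> Neg ` arcs G \<union> Pos ` arcs G"

inductive gis_rel :: "('v, 'e) pre_digraph \<Rightarrow> ('v, 'e) gen list \<Rightarrow> ('v, 'e) gen list \<Rightarrow> bool"
  for G where
  zero_left: "x \<in> gens G \<Longrightarrow> gis_rel G [Zero, x] [Zero]"
| zero_right: "x \<in> gens G \<Longrightarrow> gis_rel G [x, Zero] [Zero]"
| vert_idem: "u \<in> verts G \<Longrightarrow> gis_rel G [Vert u, Vert u] [Vert u]"
| vert_orth: "u \<in> verts G \<Longrightarrow> w \<in> verts G \<Longrightarrow> u \<noteq> w \<Longrightarrow> gis_rel G [Vert u, Vert w] [Zero]"
| neg_source: "e \<in> arcs G \<Longrightarrow> gis_rel G [Vert (tail G e), Neg e] [Neg e]"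
| neg_target: "e \<in> arcs G \<Longrightarrow> gis_rel G [Neg e, Vert (head G e)] [Neg e]"
| pos_source: "e \<in> arcs G \<Longrightarrow> gis_rel G [Vert (head G e), Pos e] [Pos e]"
| pos_target: "e \<in> arcs G \<Longrightarrow> gis_rel G [Pos e, Vert (tail G e)] [Pos e]"
| neg_pos_same: "f \<in> arcs G \<Longrightarrow> gis_rel G [Neg f, Pos f] [Vert (tail G f)]"
| neg_pos_diff: "f \<in> arcs G \<Longrightarrow> g \<in> arcs G \<Longrightarrow> f \<noteq> g \<Longrightarrow> gis_rel G [Neg f, Pos g] [Zero]"

text \<open>
  The congruence generated by the relations on the free semigroup (nonempty words) over the
  generators.
\<close>

inductive gis_cong :: "('v, 'e) pre_digraph \<Rightarrow> ('v, 'e) gen list \<Rightarrow> ('v, 'e) gen list \<Rightarrow> bool"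
  for G where
  rel: "gis_rel G u v \<Longrightarrow> gis_cong G u v"
| refl: "w \<in> lists (gens G) \<Longrightarrow> w \<noteq> [] \<Longrightarrow> gis_cong G w w"
| sym: "gis_cong G u v \<Longrightarrow> gis_cong G v u"
| trans: "gis_cong G u v \<Longrightarrow> gis_cong G v w \<Longrightarrow> gis_cong G u w"
| mult: "gis_cong G u v \<Longrightarrow> gis_cong G u' v' \<Longrightarrow> gis_cong G (u @ u') (v @ v')"

text \<open>
  The elements of the graph inverse semigroup are the congruence classes of nonempty words; the
  class of \<open>w\<close> is the product of the letters of \<open>w\<close> in it.
\<close>

definition gis_prod :: "('v, 'e) pre_digraph \<Rightarrow> ('v, 'e) gen list \<Rightarrow> ('v, 'e) gen list set" where
  "gis_prod G w = {u. gis_cong G w u}"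

abbreviation gis_zero :: "('v, 'e) pre_digraph \<Rightarrow> ('v, 'e) gen list set" where
  "gis_zero G \<equiv> gis_prod G [Zero]"

abbreviation gis_P :: "('v, 'e) pre_digraph \<Rightarrow> 'v \<Rightarrow> ('v, 'e) gen list set" where
  "gis_P G v \<equiv> gis_prod G [Vert v]"


subsection \<open>Subshifts and zeta functions\<close>

definition shift :: "(int \<Rightarrow> 'a) \<Rightarrow> int \<Rightarrow> 'a" where
  "shift x = (\<lambda>i. x (i + 1))"

definition subword :: "(int \<Rightarrow> 'a) \<Rightarrow> int \<Rightarrow> nat \<Rightarrow> 'a list" where
  "subword x i n = map (\<lambda>k. x (i + int k)) [0..<n]"

definition subshift_of :: "'a list set \<Rightarrow> (int \<Rightarrow> 'a) set" where
  "subshift_of L = {x. \<forall>i n. 0 < n \<longrightarrow> subword x i n \<in> L}"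

definition admissible_words :: "(int \<Rightarrow> 'a) set \<Rightarrow> 'a list set" where
  "admissible_words X = {subword x i n | x i n. x \<in> X \<and> 0 < n}"

definition num_periodic :: "(int \<Rightarrow> 'a) set \<Rightarrow> nat \<Rightarrow> nat" where
  "num_periodic X n = card {x \<in> X. (shift ^^ n) x = x}"

definition zeta :: "(int \<Rightarrow> 'a) set \<Rightarrow> real fps" where
  "zeta X = fps_compose (fps_exp 1)
     (Abs_fps (\<lambda>n. if n = 0 then 0 else of_nat (num_periodic X n) / of_nat n))"

definition gen_fun :: "'a list set \<Rightarrow> real fps" where
  "gen_fun L = Abs_fps (\<lambda>n. of_nat (card {w \<in> L. length w = n}))"


subsection \<open>Markov-Dyck shifts and codes\<close>

definition alphabet :: "('v, 'e) pre_digraph \<Rightarrow> ('v, 'e) gen set" where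
  "alphabet G = Neg ` arcs G \<union> Pos ` arcs G"

definition dyck_words :: "('v, 'e) pre_digraph \<Rightarrow> ('v, 'e) gen list set" where
  "dyck_words G = {w \<in> lists (alphabet G). w \<noteq> [] \<and> gis_prod G w \<noteq> gis_zero G}"

definition markov_dyck_shift :: "('v, 'e) pre_digraph \<Rightarrow> (int \<Rightarrow> ('v, 'e) gen) set" where
  "markov_dyck_shift G = subshift_of (dyck_words G)"

definition markov_dyck_code :: "('v, 'e) pre_digraph \<Rightarrow> 'v \<Rightarrow> ('v, 'e) gen list set" where
  "markov_dyck_code G v = {c \<in> lists (alphabet G). c \<noteq> [] \<and> gis_prod G c = gis_P G v \<and>
     (\<forall>J. 1 \<le> J \<and> J < length c \<longrightarrow> gis_prod G (take J c) \<noteq> gis_P G v)}"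


subsection \<open>Matrices\<close>

text \<open>Matrices are indexed by the positions of an enumeration \<open>vs\<close> of the vertices.\<close>

definition adjacency_mat :: "('v, 'e) pre_digraph \<Rightarrow> 'v list \<Rightarrow> real fps mat" where
  "adjacency_mat G vs = mat (length vs) (length vs)
     (\<lambda>(i, j). of_nat (card {e \<in> arcs G. tail G e = vs ! i \<and> head G e = vs ! j}))"

definition code_mat :: "('v, 'e) pre_digraph \<Rightarrow> 'v list \<Rightarrow> real fps mat" where
  "code_mat G vs = mat_diag (length vs) (\<lambda>i. gen_fun (markov_dyck_code G (vs ! i)))"

definition code_star_mat :: "('v, 'e) pre_digraph \<Rightarrow> 'v list \<Rightarrow> real fps mat" where
  "code_star_mat G vs = mat_diag (length vs) (\<lambda>i. 1 / (1 - gen_fun (markov_dyck_code G (vs ! i))))"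


subsection \<open>The language of the Markov-Dyck shift\<close>

text \<open>
  \<open>dyck_words G\<close> is factorial and extensible, so it is indeed the language of
  \<open>markov_dyck_shift G\<close>, for every graph.
\<close>

primrec gen_star :: "('v, 'e) gen \<Rightarrow> ('v, 'e) gen" where
  "gen_star Zero = Zero"
| "gen_star (Vert v) = Vert v"
| "gen_star (Neg e) = Pos e"
| "gen_star (Pos e) = Neg e"

lemma gen_star_alphabet: "x \<in> alphabet G \<Longrightarrow> gen_star x \<in> alphabet G"
  by (auto simp: alphabet_def)

lemma alphabet_gens: "alphabet G \<subseteq> gens G"
  by (auto simp: alphabet_def gens_def)

lemma gis_cong_append_left:
  assumes "gis_cong G u v" "w \<in> lists (gens G)"
  shows "gis_cong G (w @ u) (w @ v)"
  using assms by (cases "w = []") (auto intro: gis_cong.mult gis_cong.refl)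

lemma gis_cong_append_right:
  assumes "gis_cong G u v" "w \<in> lists (gens G)"
  shows "gis_cong G (u @ w) (v @ w)"
  using assms gis_cong.mult[OF assms(1) gis_cong.refl[of w G]] by (cases "w = []") auto

lemma gis_cong_zero_left: "w \<in> lists (gens G) \<Longrightarrow> gis_cong G (Zero # w) [Zero]"
proof (induction w)
  case Nil
  show ?case by (rule gis_cong.refl) (auto simp: gens_def)
next
  case (Cons x w)
  have "gis_cong G ([Zero, x] @ w) ([Zero] @ w)"
    using Cons.prems by (intro gis_cong_append_right gis_cong.rel gis_rel.zero_left) auto
  moreover have "gis_cong G (Zero # w) [Zero]" using Cons by simp
  ultimately show ?case using gis_cong.trans[of G "Zero # x # w" "Zero # w" "[Zero]"] by simp
qed

lemma gis_cong_zero_right: "w \<in> lists (gens G) \<Longrightarrow> gis_cong G (w @ [Zero]) [Zero]"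
proof (induction w)
  case Nil
  show ?case using gis_cong.refl[of "[Zero]" G] by (auto simp: gens_def)
next
  case (Cons x w)
  have "gis_cong G ([x] @ (w @ [Zero])) ([x] @ [Zero])"
    using Cons by (intro gis_cong_append_left) auto
  moreover have "gis_cong G ([x] @ [Zero]) [Zero]"
    using Cons.prems by (auto intro: gis_cong.rel gis_rel.zero_right)
  ultimately have "gis_cong G ([x] @ (w @ [Zero])) [Zero]" by (rule gis_cong.trans)
  then show ?case by simp
qed

lemma gis_cong_zero_factor:
  assumes "gis_cong G w [Zero]" "u \<in> lists (gens G)" "v \<in> lists (gens G)"
  shows "gis_cong G (u @ w @ v) [Zero]"
proof -
  have "gis_cong G (u @ w @ v) (u @ [Zero] @ v)"
    by (intro gis_cong_append_left gis_cong_append_right assms)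
  moreover have "gis_cong G (u @ [Zero] @ v) (u @ [Zero])"
    using gis_cong_append_left[OF gis_cong_zero_left[OF assms(3)] assms(2)] by simp
  ultimately have "gis_cong G (u @ w @ v) (u @ [Zero])" by (rule gis_cong.trans)
  then show ?thesis using gis_cong_zero_right[OF assms(2)] by (rule gis_cong.trans)
qed

lemma gis_prod_eq_zero_iff: "gis_prod G w = gis_zero G \<longleftrightarrow> gis_cong G w [Zero]"
proof -
  have "gis_cong G [Zero] [Zero]" by (rule gis_cong.refl) (auto simp: gens_def)
  moreover have "gis_cong G w u \<longleftrightarrow> gis_cong G [Zero] u" if "gis_cong G w [Zero]" for u
    using that gis_cong.sym[OF that] gis_cong.trans[of G] by metis
  ultimately show ?thesis
    unfolding gis_prod_def by blast
qed

lemma gis_cong_star: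
  assumes "wf_digraph G" "x \<in> alphabet G"
  shows "gis_cong G [x, gen_star x, x] [x]"
proof -
  have al: "Neg e \<in> gens G" "Pos e \<in> gens G" if "e \<in> arcs G" for e
    using that by (auto simp: gens_def)
  consider e where "e \<in> arcs G" "x = Neg e" | e where "e \<in> arcs G" "x = Pos e"
    using assms(2) by (auto simp: alphabet_def)
  then show ?thesis
  proof cases
    case (1 e)
    have "gis_cong G ([Neg e, Pos e] @ [Neg e]) ([Vert (tail G e)] @ [Neg e])"
      using 1 al by (intro gis_cong_append_right gis_cong.rel gis_rel.neg_pos_same) auto
    moreover have "gis_cong G [Vert (tail G e), Neg e] [Neg e]"
      using 1 by (intro gis_cong.rel gis_rel.neg_source)
    ultimately have "gis_cong G [Neg e, Pos e, Neg e] [Neg e]"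
      by (simp only: append.simps) (rule gis_cong.trans)
    then show ?thesis using 1 by simp
  next
    case (2 e)
    have "gis_cong G ([Pos e] @ [Neg e, Pos e]) ([Pos e] @ [Vert (tail G e)])"
      using 2 al by (intro gis_cong_append_left gis_cong.rel gis_rel.neg_pos_same) auto
    moreover have "gis_cong G [Pos e, Vert (tail G e)] [Pos e]"
      using 2 by (intro gis_cong.rel gis_rel.pos_target)
    ultimately have "gis_cong G [Pos e, Neg e, Pos e] [Pos e]"
      by (simp only: append.simps) (rule gis_cong.trans)
    then show ?thesis using 2 by simp
  qed
qed

lemma subword_add: "subword x i (m + n) = subword x i m @ subword x (i + int m) n"
proof -
  have "[0..<m + n] = [0..<m] @ map (\<lambda>k. k + m) [0..<n]"
    using upt_add_eq_append[of 0 m n] map_add_upt[of m n] by (simp add: add.commute)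
  then show ?thesis by (simp add: subword_def o_def add_ac)
qed

lemma subword_2: "subword x i 2 = [x i, x (i + 1)]"
  by (simp add: subword_def numeral_2_eq_2)

theorem admissible_words_markov_dyck_shift:
  assumes wf: "wf_digraph G"
  shows "admissible_words (markov_dyck_shift G) = dyck_words G"
proof
  show "admissible_words (markov_dyck_shift G) \<subseteq> dyck_words G"
    by (auto simp: admissible_words_def markov_dyck_shift_def subshift_of_def)
next
  show "dyck_words G \<subseteq> admissible_words (markov_dyck_shift G)"
  proof
    fix w assume "w \<in> dyck_words G"
    then have w: "w \<in> lists (alphabet G)" "w \<noteq> []" "\<not> gis_cong G w [Zero]"
      by (auto simp: dyck_words_def gis_prod_eq_zero_iff)
    define n where "n = length w"
    define a where "a = hd w"
    define b where "b = last w"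
    have ab: "a \<in> alphabet G" "b \<in> alphabet G"
      using w by (auto simp: a_def b_def)
    have wg: "w \<in> lists (gens G)" using w alphabet_gens by fast
    have sg: "a \<in> gens G" "b \<in> gens G" "gen_star a \<in> gens G" "gen_star b \<in> gens G"
      using ab gen_star_alphabet alphabet_gens by (fast+)
    define x where "x i = (if i < 0 then (if even i then a else gen_star a)
       else if i < int n then w ! nat i
       else if even (i - int n) then gen_star b else b)" for i
    have xal: "x i \<in> alphabet G" for i
      using ab gen_star_alphabet[of _ G] w(1) by (auto simp: x_def n_def)
    have xg: "subword x i m \<in> lists (gens G)" for i m
      using xal by (auto simp: subword_def intro!: subsetD[OF alphabet_gens])
    have x0: "subword x 0 n = w"
      by (rule nth_equalityI) (auto simp: subword_def x_def n_def)
    have "gis_cong G (subword x (- 2 * int k) (2 * k + n + 2 * k)) w" for k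
    proof -
      have left: "gis_cong G (subword x (- 2 * int k) (2 * k) @ w) w" for k
      proof (induction k)
        case 0
        show ?case using wg w(2) by (auto simp: subword_def intro: gis_cong.refl)
      next
        case (Suc k)
        have e: "subword x (- 2 * int (Suc k)) (2 * Suc k)
            = [a, gen_star a] @ subword x (- 2 * int k) (2 * k)"
          using subword_add[of x "- 2 * int (Suc k)" 2 "2 * k"]
          by (simp add: subword_2 x_def)
        have "gis_cong G ([a, gen_star a] @ (subword x (- 2 * int k) (2 * k) @ w))
            ([a, gen_star a] @ w)"
          using Suc sg by (intro gis_cong_append_left) auto
        moreover have "gis_cong G ([a, gen_star a, a] @ tl w) ([a] @ tl w)"
          using wg w(2) by (intro gis_cong_append_right gis_cong_star wf ab) (cases w; auto)
        moreover have "[a] @ tl w = w" "[a, gen_star a, a] @ tl w = [a, gen_star a] @ w"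
          using w(2) by (simp_all add: a_def)
        ultimately have "gis_cong G ([a, gen_star a] @ (subword x (- 2 * int k) (2 * k) @ w)) w"
          by (simp only:) (rule gis_cong.trans)
        then show ?case unfolding e by simp
      qed
      have right: "gis_cong G (w @ subword x (int n) (2 * k)) w" for k
      proof (induction k)
        case 0
        show ?case using wg w(2) by (auto simp: subword_def intro: gis_cong.refl)
      next
        case (Suc k)
        have e: "subword x (int n) (2 * Suc k) = subword x (int n) (2 * k) @ [gen_star b, b]"
          using subword_add[of x "int n" "2 * k" 2]
          by (simp add: subword_2 x_def)
        have "gis_cong G ((w @ subword x (int n) (2 * k)) @ [gen_star b, b])
            (w @ [gen_star b, b])"
          using Suc sg by (intro gis_cong_append_right) auto
        moreover have "gis_cong G (butlast w @ [b, gen_star b, b]) (butlast w @ [b])"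
          using wg by (intro gis_cong_append_left gis_cong_star wf ab) (auto dest: in_set_butlastD)
        moreover have "butlast w @ [b] = w" using w(2) by (simp add: b_def)
        moreover have "butlast w @ [b, gen_star b, b] = w @ [gen_star b, b]"
          using arg_cong[OF \<open>butlast w @ [b] = w\<close>, of "\<lambda>u. u @ [gen_star b, b]"] by simp
        ultimately have "gis_cong G ((w @ subword x (int n) (2 * k)) @ [gen_star b, b]) w"
          by (simp only:) (rule gis_cong.trans)
        then show ?case unfolding e by simp
      qed
      have "subword x (- 2 * int k) (2 * k + n + 2 * k)
          = (subword x (- 2 * int k) (2 * k) @ w) @ subword x (int n) (2 * k)"
        using subword_add[of x "- 2 * int k" "2 * k + n" "2 * k"]
          subword_add[of x "- 2 * int k" "2 * k" n] x0 by simp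
      then show ?thesis
        using gis_cong.trans[OF gis_cong_append_right[OF left xg] right] by simp
    qed
    then have full: "\<not> gis_cong G (subword x (- 2 * int k) (2 * k + n + 2 * k)) [Zero]" for k
      using w(3) gis_cong.trans[OF gis_cong.sym] by blast
    have "subword x i m \<in> dyck_words G" if "0 < m" for i m
    proof -
      define k where "k = nat \<bar>i\<bar> + m"
      define p where "p = nat (i + 2 * int k)"
      define q where "q = 2 * k + n + 2 * k - p - m"
      have p: "int p = i + 2 * int k" by (simp add: p_def k_def)
      have "p + m \<le> 2 * k + n + 2 * k"
        by (simp add: p_def k_def)
      then have "2 * k + n + 2 * k = p + (m + q)" by (simp add: q_def)
      then have "subword x (- 2 * int k) (2 * k + n + 2 * k)
          = subword x (- 2 * int k) p @ subword x i m @ subword x (i + int m) q"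
        by (simp only: subword_add p) simp
      then have "\<not> gis_cong G (subword x i m) [Zero]"
        using full[of k] gis_cong_zero_factor[OF _ xg xg, of "subword x i m"] by auto
      moreover have "subword x i m \<in> lists (alphabet G)" "subword x i m \<noteq> []"
        using xal that by (auto simp: subword_def)
      ultimately show ?thesis by (simp add: dyck_words_def gis_prod_eq_zero_iff)
    qed
    then have "x \<in> markov_dyck_shift G"
      by (auto simp: markov_dyck_shift_def subshift_of_def)
    moreover have "0 < n" using w(2) by (simp add: n_def)
    ultimately show "w \<in> admissible_words (markov_dyck_shift G)"
      unfolding admissible_words_def using x0[symmetric] by blast
  qed
qed

end

theory Submission
  imports Defs
begin

text \<open>
  Read a word as instructions for a stack of arcs over a current vertex: \<open>Neg e\<close> pushes \<open>e\<close> and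
  \<open>Pos e\<close> pops it.  This partial action of words respects the defining relations, and it separates
  enough elements of the graph inverse semigroup: over the alphabet of the shift, a word has a
  nonzero product iff it acts somewhere (\<open>nonzero_iff_run\<close>), and its product is $P_v$ iff it takes
  the empty stack at \<open>v\<close> to itself (\<open>vertex_iff_run\<close>).  From then on only the stack matters.

  Give $e^-$ height $1$ and $e^+$ height $-1$, and call the height of one period of a periodic point
  its drift.  The reversal $x_i \mapsto x_{-i}^*$, which exchanges $e^-$ and $e^+$, maps the points of
  positive drift onto those of negative drift.  Hence the number of points of period $n$ is twice
  the number of points of drift $\geq 0$, minus the number of points of drift $0$.

  A point of drift $\geq 0$ has positions after which the stack never falls below its level there.
  Cut at all these positions (boundaries), the point becomes a bi-infinite path of blocks,
  where a block from \<open>u\<close> to \<open>t\<close> is a code word of \<open>u\<close> (if \<open>t = u\<close>) or an arc $e^-$ from \<open>u\<close> to \<open>t\<close>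
  that is never popped.  The matrix of generating functions of the blocks is \<open>H = D + A z\<close>.  Words
  that can act on an empty stack factor uniquely into blocks, so their generating functions form the
  matrix $S = (1 - H)^{-1}$.  A periodic point of drift $\geq 0$ is determined by the closed block
  path that starts with the block covering position $0$, together with the place of position $0$
  in this block; marking a place in a block replaces \<open>H\<close> by $z H'$, and so these points have the
  counting series \<open>tr (z H' S)\<close>.  In the same way, with code words as the only blocks, the
  points of drift $0$ have the counting series $\mathrm{tr}(z D' (1 - D)^{-1})$.

  By Jacobi's formula, $\mathrm{tr}(z H' (1 - H)^{-1})$ is minus the logarithmic derivative
  $z\,d/dz$ of $\det(1 - H)$.  Comparing logarithmic derivatives gives
  $\zeta = \det(1 - D) / \det(1 - H)^2$ (\<open>zeta_eq_det_quotients\<close>), and both claimed forms follow from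
  the factorization $1 - H = (1 - D)(1 - D^* A z)$.
\<close>

section \<open>The partial action of words on stacks of arcs\<close>

text \<open>
  The state is the current vertex together with the pushed arcs, the last one first.  The vertex has
  to be recorded because $P_u P_w = 0$ for $u \neq w$: a letter must not act away from its source.
\<close>

fun step :: "('v, 'e) pre_digraph \<Rightarrow> ('v, 'e) gen \<Rightarrow> 'v \<times> 'e list \<Rightarrow> ('v \<times> 'e list) option" where
  "step G Zero s = None"
| "step G (Vert u) (v, st) = (if u = v then Some (v, st) else None)"
| "step G (Neg e) (v, st) = (if v = tail G e then Some (head G e, e # st) else None)"
| "step G (Pos e) (v, []) = None"
| "step G (Pos e) (v, f # st) =
     (if e = f \<and> v = head G e then Some (tail G e, st) else None)"

primrec run :: "('v, 'e) pre_digraph \<Rightarrow> ('v, 'e) gen list \<Rightarrow> 'v \<times> 'e list \<Rightarrow> ('v \<times> 'e list) option" where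
  "run G [] s = Some s"
| "run G (x # w) s = Option.bind (step G x s) (run G w)"

lemma run_append: "run G (w @ w') s = Option.bind (run G w s) (run G w')"
proof (induction w arbitrary: s)
  case (Cons x w)
  have "run G (w @ w') = (\<lambda>s. Option.bind (run G w s) (run G w'))" using Cons by blast
  then show ?case by (simp add: bind_assoc)
qed simp

lemma gis_rel_run: "gis_rel G w w' \<Longrightarrow> run G w s = run G w' s"
proof (induction rule: gis_rel.induct)
  case (zero_right x)
  then show ?case by (cases s; cases "step G x s") auto
next
  case (pos_source e)
  then show ?case by (cases s; cases "snd s") auto
next
  case (pos_target e)
  then show ?case by (cases s; cases "snd s") auto
qed (cases s; auto)+

text \<open>
  The action is a representation of the graph inverse semigroup; it is used to prove that words are
  not congruent.
\<close>

lemma gis_cong_run: "gis_cong G w w' \<Longrightarrow> run G w s = run G w' s"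
proof (induction arbitrary: s rule: gis_cong.induct)
  case (rel u v)
  then show ?case by (rule gis_rel_run)
next
  case (mult u v u' v')
  then have "run G u = run G v" "run G u' = run G v'" by (simp_all only: fun_eq_iff) simp_all
  then show ?case by (simp only: run_append)
qed simp_all

lemma run_gis_zero: "gis_cong G w [Zero] \<Longrightarrow> run G w s = None"
  using gis_cong_run[of G w "[Zero]" s] by simp

text \<open>
  The stack \<open>st\<close>, read from bottom to top, is a path in \<open>G\<close> from \<open>r\<close> to \<open>v\<close>.
\<close>

fun path_stack :: "('v, 'e) pre_digraph \<Rightarrow> 'v \<Rightarrow> 'e list \<Rightarrow> 'v \<Rightarrow> bool" where
  "path_stack G r [] v \<longleftrightarrow> v = r"
| "path_stack G r (e # st) v \<longleftrightarrow> head G e = v \<and> path_stack G r st (tail G e)"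

lemma step_path_stack:
  "step G x (u, st) = Some (v, st') \<Longrightarrow> path_stack G r st u \<Longrightarrow> path_stack G r st' v"
  by (cases "(G, x, (u, st))" rule: step.cases) (auto split: if_splits)

lemma run_path_stack:
  "run G w (u, st) = Some (v, st') \<Longrightarrow> path_stack G r st u \<Longrightarrow> path_stack G r st' v"
proof (induction w arbitrary: u st)
  case (Cons x w)
  then obtain u1 st1 where 1: "step G x (u, st) = Some (u1, st1)" "run G w (u1, st1) = Some (v, st')"
    by (auto simp: bind_eq_Some_conv)
  show ?case by (rule Cons.IH[OF 1(2) step_path_stack[OF 1(1) Cons.prems(2)]])
qed auto

text \<open>
  An empty stack is a path of length zero, so emptying the stack brings the action back to the
  starting vertex.
\<close>

lemma run_closed: "run G w (u, []) = Some (v, []) \<Longrightarrow> v = u"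
  using run_path_stack[of G w u "[]" v "[]" u] by auto

lemma step_append_stack:
  "step G x (u, st) = Some (v, st') \<Longrightarrow> step G x (u, st @ t) = Some (v, st' @ t)"
  by (cases "(G, x, (u, st))" rule: step.cases) (auto split: if_splits)

text \<open>
  Arcs at the bottom of the stack that are never reached do not influence the action.
\<close>

lemma run_append_stack:
  "run G w (u, st) = Some (v, st') \<Longrightarrow> run G w (u, st @ t) = Some (v, st' @ t)"
proof (induction w arbitrary: u st)
  case (Cons x w)
  then obtain u1 st1 where 1: "step G x (u, st) = Some (u1, st1)" "run G w (u1, st1) = Some (v, st')"
    by (auto simp: bind_eq_Some_conv)
  show ?case using Cons.IH[OF 1(2)] step_append_stack[OF 1(1)] by simp
qed auto

section \<open>Normal forms in the graph inverse semigroup\<close>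

text \<open>
  The normal form of a nonzero element: first arcs are popped from a given stack, then the
  stack \<open>st\<close> is pushed.  The vertex in the middle keeps the word nonempty.
\<close>

definition stack_word :: "'e list \<Rightarrow> 'v \<Rightarrow> 'e list \<Rightarrow> ('v, 'e) gen list" where
  "stack_word p r st = map Pos p @ Vert r # map Neg (rev st)"

lemma in_gens_iff [simp]:
  "Vert v \<in> gens G \<longleftrightarrow> v \<in> verts G" "Neg e \<in> gens G \<longleftrightarrow> e \<in> arcs G" "Pos e \<in> gens G \<longleftrightarrow> e \<in> arcs G"
  by (auto simp: gens_def)

lemma in_alphabet_iff [simp]:
  "Vert v \<notin> alphabet G" "Zero \<notin> alphabet G"
  "Neg e \<in> alphabet G \<longleftrightarrow> e \<in> arcs G" "Pos e \<in> alphabet G \<longleftrightarrow> e \<in> arcs G"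
  by (auto simp: alphabet_def)

lemma path_stack_in_verts:
  assumes "wf_digraph G" "r \<in> verts G" "path_stack G r st v" "set st \<subseteq> arcs G"
  shows "v \<in> verts G"
  using assms by (cases st) (auto simp: wf_digraph.head_in_verts)

lemma stack_word_gens:
  assumes "r \<in> verts G" "set st \<subseteq> arcs G" "set p \<subseteq> arcs G"
  shows "stack_word p r st \<in> lists (gens G)"
  using assms by (auto simp: stack_word_def subset_eq)

lemma stack_word_end:
  assumes "wf_digraph G" "r \<in> verts G" "path_stack G r st v" "set st \<subseteq> arcs G" "set p \<subseteq> arcs G"
  shows "gis_cong G (stack_word p r st @ [Vert v]) (stack_word p r st)"
proof (cases st)
  case Nil
  have "gis_cong G (map Pos p @ [Vert r, Vert r]) (map Pos p @ [Vert r])"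
    using assms by (intro gis_cong_append_left gis_cong.rel gis_rel.vert_idem) (auto simp: subset_eq)
  then show ?thesis using Nil assms by (simp add: stack_word_def)
next
  case (Cons e st')
  have "gis_cong G ((map Pos p @ Vert r # map Neg (rev st')) @ [Neg e, Vert (head G e)])
     ((map Pos p @ Vert r # map Neg (rev st')) @ [Neg e])"
    using assms Cons
    by (intro gis_cong_append_left gis_cong.rel gis_rel.neg_target) (auto simp: subset_eq)
  then show ?thesis using Cons assms by (simp add: stack_word_def)
qed

lemma stack_word_step_zero:
  assumes "wf_digraph G" "r \<in> verts G" "path_stack G r st v" "set st \<subseteq> arcs G" "set p \<subseteq> arcs G"
    and "gis_cong G [Vert v, x] [Zero]" "x \<in> gens G"
  shows "gis_cong G (stack_word p r st @ [x]) [Zero]"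
proof -
  note g = stack_word_gens[OF assms(2,4,5)]
  have "gis_cong G ((stack_word p r st @ [Vert v]) @ [x]) (stack_word p r st @ [x])"
    by (intro gis_cong_append_right stack_word_end assms) (use assms in auto)
  moreover have "gis_cong G (stack_word p r st @ [Vert v, x] @ []) [Zero]"
    by (rule gis_cong_zero_factor) (use assms g in auto)
  ultimately show ?thesis
    using gis_cong.trans[OF gis_cong.sym, of G "(stack_word p r st @ [Vert v]) @ [x]"] by simp
qed

text \<open>
  A letter absorbs the projection at its source, and the projection at any other vertex is
  orthogonal to that one.
\<close>

lemma vert_mismatch:
  assumes "x \<in> gens G" "gis_cong G [Vert u, x] [x]" "u \<in> verts G" "v \<in> verts G" "u \<noteq> v"
  shows "gis_cong G [Vert v, x] [Zero]"
proof -
  have g: "[Vert v] \<in> lists (gens G)" "[x] \<in> lists (gens G)" using assms by auto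
  have "gis_cong G ([Vert v] @ [x]) ([Vert v] @ [Vert u, x])"
    by (intro gis_cong_append_left gis_cong.sym[OF assms(2)] g)
  moreover have "gis_cong G ([] @ [Vert v, Vert u] @ [x]) [Zero]"
    by (rule gis_cong_zero_factor) (use assms g in \<open>auto intro: gis_cong.rel gis_rel.vert_orth\<close>)
  ultimately show ?thesis
    using gis_cong.trans[of G "[Vert v] @ [x]"] by simp
qed

text \<open>
  Multiplying a normal form by one more letter gives zero or a normal form again, according to
  whether the letter can act on the stack.  The stack \<open>p\<close> on which the word acts must be enlarged
  exactly when a letter pops from the empty stack; then the letter joins the first part of the normal form.
\<close>

lemma normal_form_step:
  assumes wf: "wf_digraph G" and r: "r \<in> verts G" and x: "x \<in> alphabet G"
    and ps: "path_stack G r st v" and ar: "set st \<subseteq> arcs G" "set p \<subseteq> arcs G"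
    and rn: "run G w (u, p) = Some (v, st)"
  shows "gis_cong G (stack_word p r st @ [x]) [Zero] \<or>
    (\<exists>p' r' st' v'. gis_cong G (stack_word p r st @ [x]) (stack_word p' r' st') \<and>
       run G (w @ [x]) (u, p') = Some (v', st') \<and> path_stack G r' st' v' \<and> r' \<in> verts G \<and>
       set st' \<subseteq> arcs G \<and> set p' \<subseteq> arcs G)"
proof -
  have v: "v \<in> verts G" by (rule path_stack_in_verts[OF wf r ps ar(1)])
  have xg: "x \<in> gens G" using x alphabet_gens by blast
  note g = stack_word_gens[OF r ar]
  consider e where "x = Neg e" "e \<in> arcs G" | e where "x = Pos e" "e \<in> arcs G"
    using x by (auto simp: alphabet_def)
  then show ?thesis
  proof cases
    case (1 e)
    show ?thesis
    proof (cases "tail G e = v")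
      case True
      have "stack_word p r st @ [x] = stack_word p r (e # st)" by (simp add: stack_word_def 1)
      moreover have "stack_word p r (e # st) \<in> lists (gens G)"
        by (rule stack_word_gens) (use r ar 1 in auto)
      ultimately have "gis_cong G (stack_word p r st @ [x]) (stack_word p r (e # st))"
        using gis_cong.refl[of "stack_word p r (e # st)" G] by (simp add: stack_word_def)
      moreover have "run G (w @ [x]) (u, p) = Some (head G e, e # st)"
        using rn True 1 by (simp add: run_append)
      moreover have "path_stack G r (e # st) (head G e)" using ps True by simp
      moreover have "set (e # st) \<subseteq> arcs G" using 1 ar by simp
      ultimately show ?thesis using r ar by blast
    next
      case False
      have "gis_cong G [Vert v, x] [Zero]"
        by (rule vert_mismatch[of _ _ "tail G e"])
          (use 1 v False xg wf in \<open>auto intro: gis_cong.rel gis_rel.neg_source simp: wf_digraph.tail_in_verts\<close>)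
      from stack_word_step_zero[OF wf r ps ar this xg] show ?thesis by simp
    qed
  next
    case (2 e)
    show ?thesis
    proof (cases st)
      case Nil
      then have vr: "v = r" using ps by simp
      show ?thesis
      proof (cases "head G e = r")
        case True
        have "gis_cong G (map Pos p @ [Vert (head G e), Pos e]) (map Pos p @ [Pos e])"
          using ar 2
          by (intro gis_cong_append_left gis_cong.rel gis_rel.pos_source) (auto simp: subset_eq)
        moreover have "gis_cong G (map Pos p @ [Pos e, Vert (tail G e)]) (map Pos p @ [Pos e])"
          using ar 2
          by (intro gis_cong_append_left gis_cong.rel gis_rel.pos_target) (auto simp: subset_eq)
        ultimately have "gis_cong G (map Pos p @ [Vert (head G e), Pos e]) (map Pos p @ [Pos e, Vert (tail G e)])"
          by (rule gis_cong.trans[OF _ gis_cong.sym])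
        then have "gis_cong G (stack_word p r st @ [x]) (stack_word (p @ [e]) (tail G e) [])"
          using Nil True 2 by (simp add: stack_word_def)
        moreover have "run G (w @ [x]) (u, p @ [e]) = Some (tail G e, [])"
          using run_append_stack[OF rn, of "[e]"] 2 True Nil vr by (simp add: run_append)
        moreover have "path_stack G (tail G e) [] (tail G e)" "tail G e \<in> verts G"
          "set [] \<subseteq> arcs G" "set (p @ [e]) \<subseteq> arcs G"
          using 2 ar wf by (auto simp: wf_digraph.tail_in_verts)
        ultimately show ?thesis by blast
      next
        case False
        have "gis_cong G [Vert v, x] [Zero]"
          by (rule vert_mismatch[of _ _ "head G e"])
            (use 2 v vr False xg wf in \<open>auto intro: gis_cong.rel gis_rel.pos_source simp: wf_digraph.head_in_verts\<close>)
        from stack_word_step_zero[OF wf r ps ar this xg] show ?thesis by simp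
      qed
    next
      case (Cons f st')
      have sw: "stack_word p r st @ [x] = stack_word p r st' @ [Neg f, Pos e]"
        using Cons 2 by (simp add: stack_word_def)
      have f: "f \<in> arcs G" "set st' \<subseteq> arcs G" using ar Cons by auto
      have ps': "path_stack G r st' (tail G f)" "v = head G f" using ps Cons by auto
      note g' = stack_word_gens[OF r f(2) ar(2)]
      show ?thesis
      proof (cases "f = e")
        case True
        have "gis_cong G (stack_word p r st' @ [Neg f, Pos e]) (stack_word p r st' @ [Vert (tail G f)])"
          using True f by (intro gis_cong_append_left[OF _ g'] gis_cong.rel) (auto intro: gis_rel.neg_pos_same)
        from gis_cong.trans[OF this stack_word_end[OF wf r ps'(1) f(2) ar(2)]]
        have "gis_cong G (stack_word p r st @ [x]) (stack_word p r st')" using sw by simp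
        moreover have "run G (w @ [x]) (u, p) = Some (tail G f, st')"
          using rn True Cons 2 ps' by (simp add: run_append)
        ultimately show ?thesis using r f ar ps' by blast
      next
        case False
        have "gis_cong G (stack_word p r st' @ [Neg f, Pos e] @ []) [Zero]"
          by (rule gis_cong_zero_factor[OF _ g'])
            (use False f 2 in \<open>auto intro: gis_cong.rel gis_rel.neg_pos_diff\<close>)
        then show ?thesis using sw by simp
      qed
    qed
  qed
qed

text \<open>
  The vertex in front of the word makes the statement meaningful for the empty word, where the
  induction starts.
\<close>

lemma normal_form:
  assumes wf: "wf_digraph G" and u: "u \<in> verts G" and w: "w \<in> lists (alphabet G)"
  shows "gis_cong G (Vert u # w) [Zero] \<or>
    (\<exists>p r st v. gis_cong G (Vert u # w) (stack_word p r st) \<and>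
       run G w (u, p) = Some (v, st) \<and> path_stack G r st v \<and> r \<in> verts G \<and>
       set st \<subseteq> arcs G \<and> set p \<subseteq> arcs G)"
  using w
proof (induction w rule: rev_induct)
  case Nil
  have "gis_cong G [Vert u] (stack_word [] u [])"
    using u by (auto simp: stack_word_def intro: gis_cong.refl)
  then show ?case using u by (intro disjI2 exI[of _ "[]"] exI[of _ u]) auto
next
  case (snoc x w)
  have x: "x \<in> alphabet G" and w: "w \<in> lists (alphabet G)" using snoc.prems by auto
  have xg: "[x] \<in> lists (gens G)" using x alphabet_gens by auto
  from snoc.IH[OF w] show ?case
  proof (elim disjE exE conjE)
    assume "gis_cong G (Vert u # w) [Zero]"
    from gis_cong_zero_factor[OF this _ xg, of "[]"] show ?thesis by simp
  next
    fix p r st v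
    assume c: "gis_cong G (Vert u # w) (stack_word p r st)"
      and h: "run G w (u, p) = Some (v, st)" "path_stack G r st v" "r \<in> verts G"
        "set st \<subseteq> arcs G" "set p \<subseteq> arcs G"
    have c': "gis_cong G (Vert u # w @ [x]) (stack_word p r st @ [x])"
      using gis_cong_append_right[OF c xg] by simp
    show ?thesis
      using normal_form_step[OF wf h(3) x h(2,4,5,1)] gis_cong.trans[OF c'] by auto
  qed
qed

lemma alphabet_source:
  assumes "wf_digraph G" "x \<in> alphabet G"
  obtains u where "u \<in> verts G" "gis_cong G [Vert u, x] [x]"
proof -
  consider e where "x = Neg e" "e \<in> arcs G" | e where "x = Pos e" "e \<in> arcs G"
    using assms by (auto simp: alphabet_def)
  then show ?thesis
  proof cases
    case (1 e)
    show ?thesis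
      by (rule that[of "tail G e"])
        (use 1 assms in \<open>auto intro: gis_cong.rel gis_rel.neg_source simp: wf_digraph.tail_in_verts\<close>)
  next
    case (2 e)
    show ?thesis
      by (rule that[of "head G e"])
        (use 2 assms in \<open>auto intro: gis_cong.rel gis_rel.pos_source simp: wf_digraph.head_in_verts\<close>)
  qed
qed

lemma word_source:
  assumes "wf_digraph G" "w \<in> lists (alphabet G)" "w \<noteq> []"
  obtains u where "u \<in> verts G" "gis_cong G (Vert u # w) w"
proof -
  obtain x w' where w: "w = x # w'" using assms by (cases w) auto
  then obtain u where "u \<in> verts G" "gis_cong G [Vert u, x] [x]"
    using alphabet_source[OF assms(1)] assms(2) by auto
  moreover have "w' \<in> lists (gens G)" using assms w alphabet_gens by fastforce
  ultimately show ?thesis using that gis_cong_append_right[of G "[Vert u, x]" "[x]" w'] w by simp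
qed

lemma nonzero_iff_run:
  assumes "wf_digraph G" "w \<in> lists (alphabet G)" "w \<noteq> []"
  shows "gis_prod G w \<noteq> gis_zero G \<longleftrightarrow> (\<exists>s. run G w s \<noteq> None)"
proof
  assume "\<exists>s. run G w s \<noteq> None"
  then show "gis_prod G w \<noteq> gis_zero G"
    using run_gis_zero[of G w] by (auto simp: gis_prod_eq_zero_iff simp del: split_paired_Ex)
next
  assume nz: "gis_prod G w \<noteq> gis_zero G"
  obtain u where u: "u \<in> verts G" "gis_cong G (Vert u # w) w"
    using word_source[OF assms] .
  have "\<not> gis_cong G (Vert u # w) [Zero]"
    using nz u gis_cong.trans[OF gis_cong.sym[OF u(2)]] by (auto simp: gis_prod_eq_zero_iff)
  then obtain p v st where "run G w (u, p) = Some (v, st)"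
    using normal_form[OF assms(1) u(1) assms(2)] by blast
  then show "\<exists>s. run G w s \<noteq> None" by blast
qed

lemma gis_prod_eqI: "gis_cong G w w' \<Longrightarrow> gis_prod G w = gis_prod G w'"
  unfolding gis_prod_def by (auto intro: gis_cong.trans gis_cong.trans[OF gis_cong.sym])

lemma gis_prod_eqD:
  assumes "gis_prod G w = gis_prod G w'" "w' \<in> lists (gens G)" "w' \<noteq> []"
  shows "gis_cong G w w'"
  using assms gis_cong.refl[of w' G] unfolding gis_prod_def by auto

text \<open>
  If \<open>w\<close> fixes the empty stack at \<open>v\<close>, then so does its normal form.  This normal form therefore
  pops nothing, and what it pushes is empty, so it is \<open>[Vert v]\<close>.
\<close>

lemma vertex_iff_run:
  assumes "wf_digraph G" "w \<in> lists (alphabet G)" "w \<noteq> []" "v \<in> verts G"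
  shows "gis_prod G w = gis_P G v \<longleftrightarrow> run G w (v, []) = Some (v, [])"
proof
  assume "gis_prod G w = gis_P G v"
  then have "gis_cong G w [Vert v]" using assms by (intro gis_prod_eqD) auto
  from gis_cong_run[OF this, of "(v, [])"] show "run G w (v, []) = Some (v, [])" by simp
next
  assume r: "run G w (v, []) = Some (v, [])"
  have "\<not> gis_cong G (Vert v # w) [Zero]"
    using run_gis_zero[of G "Vert v # w" "(v, [])"] r by auto
  then obtain p r' st v' where c: "gis_cong G (Vert v # w) (stack_word p r' st)"
    and st: "run G w (v, p) = Some (v', st)" "path_stack G r' st v'"
    using normal_form[OF assms(1,4,2)] by blast
  have "run G (stack_word p r' st) (v, []) = Some (v, [])"
    using gis_cong_run[OF c, of "(v, [])"] r by simp
  then have p: "p = []" by (cases p) (auto simp: stack_word_def)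
  then have "stack_word p r' st = [Vert v]"
    using st r by (auto simp: stack_word_def)
  moreover have "gis_cong G (Vert v # w) w"
  proof -
    obtain x w' where w: "w = x # w'" using assms by (cases w) auto
    then obtain e where e: "x = Neg e" "v = tail G e"
      using r assms by (cases x) (auto simp: alphabet_def split: if_splits)
    then have "gis_cong G [Vert v, x] [x]"
      using assms w by (auto intro: gis_cong.rel gis_rel.neg_source)
    moreover have "w' \<in> lists (gens G)" using assms w alphabet_gens by fastforce
    ultimately show ?thesis using gis_cong_append_right[of G "[Vert v, x]" "[x]" w'] w by simp
  qed
  ultimately have "gis_cong G w [Vert v]" using c by (auto intro: gis_cong.trans[OF gis_cong.sym])
  then show "gis_prod G w = gis_P G v" by (rule gis_prod_eqI)
qed

section \<open>Factorization into blocks\<close>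

text \<open>
  The words that lead from \<open>u\<close> to \<open>v\<close> and never pop below the stack on which they start.
\<close>

definition up_words :: "('v, 'e) pre_digraph \<Rightarrow> 'v \<Rightarrow> 'v \<Rightarrow> ('v, 'e) gen list set" where
  "up_words G u v = {w \<in> lists (alphabet G). \<exists>st. run G w (u, []) = Some (v, st)}"

definition dyck_closed :: "('v, 'e) pre_digraph \<Rightarrow> 'v \<Rightarrow> ('v, 'e) gen list set" where
  "dyck_closed G u = {w \<in> lists (alphabet G). run G w (u, []) = Some (u, [])}"

text \<open>
  The factors between consecutive boundaries.  An arc that is popped later belongs to a code word,
  so a single letter \<open>Neg e\<close> as a block stands for an arc that remains on the stack.
\<close>

definition blocks :: "('v, 'e) pre_digraph \<Rightarrow> 'v \<Rightarrow> 'v \<Rightarrow> ('v, 'e) gen list set" where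
  "blocks G u v = (if u = v then markov_dyck_code G u else {}) \<union>
     {[Neg e] | e. e \<in> arcs G \<and> tail G e = u \<and> head G e = v}"

lemma run_empty_stack_hd:
  assumes "run G (x # w) (u, []) \<noteq> None" "x \<in> alphabet G"
  obtains e where "x = Neg e" "tail G e = u" "e \<in> arcs G"
  using assms by (cases x) (auto split: if_splits)

lemma run_take_defined: "run G w s \<noteq> None \<Longrightarrow> run G (take k w) s \<noteq> None"
  using run_append[of G "take k w" "drop k w" s] by (cases "run G (take k w) s") auto

context wf_digraph
begin

lemma code_iff:
  assumes "u \<in> verts G"
  shows "c \<in> markov_dyck_code G u \<longleftrightarrow> c \<in> lists (alphabet G) \<and> c \<noteq> [] \<and>
    run G c (u, []) = Some (u, []) \<and>
    (\<forall>k. 1 \<le> k \<and> k < length c \<longrightarrow> run G (take k c) (u, []) \<noteq> Some (u, []))"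
proof -
  have "gis_prod G (take k c) = gis_P G u \<longleftrightarrow> run G (take k c) (u, []) = Some (u, [])"
    if "c \<in> lists (alphabet G)" "c \<noteq> []" "1 \<le> k" for k
    by (rule vertex_iff_run[OF wf_digraph_axioms _ _ assms])
      (use that in \<open>auto dest: in_set_takeD\<close>)
  moreover have "gis_prod G c = gis_P G u \<longleftrightarrow> run G c (u, []) = Some (u, [])"
    if "c \<in> lists (alphabet G)" "c \<noteq> []"
    by (rule vertex_iff_run[OF wf_digraph_axioms that assms])
  ultimately show ?thesis unfolding markov_dyck_code_def mem_Collect_eq by blast
qed

lemma code_proper_prefix:
  assumes "u \<in> verts G" "c \<in> markov_dyck_code G u" "1 \<le> k" "k < length c"
  obtains v st where "run G (take k c) (u, []) = Some (v, st)" "st \<noteq> []"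
proof -
  have "run G c (u, []) = Some (u, [])" using assms by (simp add: code_iff)
  then have "run G (take k c) (u, []) \<noteq> None" using run_take_defined[of G c "(u, [])" k] by simp
  then obtain v st where r: "run G (take k c) (u, []) = Some (v, st)" by auto
  moreover have "st \<noteq> []"
    using r run_closed[of G "take k c" u v] assms by (auto simp: code_iff)
  ultimately show ?thesis by (rule that)
qed

text \<open>
  Inside a code word the stack is never empty, but at the end it is; so a proper suffix has to pop
  an arc that was pushed before it.
\<close>

lemma code_suffix_dips:
  assumes u: "u \<in> verts G" and c: "c \<in> markov_dyck_code G u" and k: "1 \<le> k" "k < length c"
  shows "run G (drop k c) (t, []) = None"
proof (rule ccontr)
  assume nn: "run G (drop k c) (t, []) \<noteq> None"
  obtain v st where r: "run G (take k c) (u, []) = Some (v, st)" "st \<noteq> []"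
    using code_proper_prefix[OF assms] .
  have rc: "run G (drop k c) (v, st) = Some (u, [])"
    using run_append[of G "take k c" "drop k c" "(u, [])"] c u r by (simp add: code_iff)
  obtain x w where d: "drop k c = x # w" using k by (cases "drop k c") auto
  have "x \<in> set c" using d by (metis in_set_dropD list.set_intros(1))
  then have "x \<in> alphabet G" using c u by (auto simp: code_iff)
  then obtain e where e: "x = Neg e" "tail G e = t"
    using run_empty_stack_hd nn unfolding d by metis
  have "v = t" using rc e unfolding d by (auto split: if_splits)
  obtain v' st' where "run G (drop k c) (t, []) = Some (v', st')" using nn by auto
  from run_append_stack[OF this, of st] have "run G (drop k c) (v, st) = Some (v', st' @ st)"
    using \<open>v = t\<close> by simp
  then show False using rc r by simp
qed

lemma Nil_notin_blocks: "[] \<notin> blocks G u t"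
  by (auto simp: blocks_def markov_dyck_code_def split: if_splits)

lemma blocks_up:
  assumes "u \<in> verts G" "b \<in> blocks G u t"
  shows "b \<in> up_words G u t"
  using assms by (auto simp: blocks_def up_words_def code_iff split: if_splits)

lemma up_words_append:
  assumes "b \<in> up_words G u t" "w \<in> up_words G t v"
  shows "b @ w \<in> up_words G u v"
proof -
  obtain s1 s2 where "run G b (u, []) = Some (t, s1)" "run G w (t, []) = Some (v, s2)"
    using assms by (auto simp: up_words_def)
  then have "run G (b @ w) (u, []) = Some (v, s2 @ s1)"
    using run_append_stack[of G w t "[]" v s2 s1] by (simp add: run_append)
  then show ?thesis using assms by (auto simp: up_words_def)
qed

text \<open>
  If one block were a proper prefix of the other, then the longer one would be a code word, and its
  remaining part would start on the empty stack as a prefix of \<open>w\<close>, which is impossible for a proper suffix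
  of a code word.
\<close>

lemma block_prefix_eq:
  assumes u: "u \<in> verts G" and bt: "b \<in> blocks G u t" "b' \<in> blocks G u t'"
    and w: "w \<in> up_words G t v" "w' \<in> up_words G t' v'" and eq: "b @ w = b' @ w'"
    and len: "length b \<le> length b'"
  shows "b = b'"
proof (rule ccontr)
  assume "b \<noteq> b'"
  have b: "b = take (length b) b'"
    using arg_cong[OF eq, of "take (length b)"] len by simp
  have lt: "length b < length b'"
  proof (rule ccontr)
    assume "\<not> ?thesis"
    then have "length b = length b'" using len by simp
    then show False using \<open>b \<noteq> b'\<close> b by simp
  qed
  have "length b \<ge> 1" using Nil_notin_blocks bt(1) by (cases b) auto
  with lt bt(2) have b': "b' \<in> markov_dyck_code G u"
    by (auto simp: blocks_def split: if_splits)
  have w_eq: "w = drop (length b) b' @ w'"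
    using arg_cong[OF eq, of "drop (length b)"] len by simp
  have "run G w (t, []) \<noteq> None" using w by (auto simp: up_words_def)
  from run_take_defined[OF this, of "length (drop (length b) b')"]
  have "run G (drop (length b) b') (t, []) \<noteq> None" unfolding w_eq by simp
  then show False using code_suffix_dips[OF u b' \<open>length b \<ge> 1\<close> lt] by simp
qed

lemma block_factorization_unique:
  assumes u: "u \<in> verts G" and bt: "b \<in> blocks G u t" "b' \<in> blocks G u t'"
    and w: "w \<in> up_words G t v" "w' \<in> up_words G t' v'" and eq: "b @ w = b' @ w'"
  shows "b = b' \<and> t = t' \<and> w = w'"
proof -
  have bb: "b = b'"
  proof (cases "length b \<le> length b'")
    case True
    then show ?thesis using block_prefix_eq[OF u bt w eq] by simp
  next
    case False
    then show ?thesis using block_prefix_eq[OF u bt(2,1) w(2,1) eq[symmetric]] by simp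
  qed
  have "t = t'"
    using blocks_up[OF u bt(1)] blocks_up[OF u bt(2)] bb by (auto simp: up_words_def)
  then show ?thesis using bb eq by simp
qed

text \<open>
  The first block ends at the first return to the empty stack.  If there is no return, then the
  first arc stays on the stack for ever, and the rest of the word also acts on the stack without it.
\<close>

lemma block_factorization_exists:
  assumes u: "u \<in> verts G" and w: "w \<in> up_words G u v" "w \<noteq> []"
  obtains t b w' where "t \<in> verts G" "b \<in> blocks G u t" "w' \<in> up_words G t v" "w = b @ w'"
proof (cases "\<exists>k. 1 \<le> k \<and> k \<le> length w \<and> run G (take k w) (u, []) = Some (u, [])")
  case True
  define k where "k = (LEAST k. 1 \<le> k \<and> k \<le> length w \<and> run G (take k w) (u, []) = Some (u, []))"
  have k: "1 \<le> k" "k \<le> length w" "run G (take k w) (u, []) = Some (u, [])"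
    using LeastI_ex[OF True] unfolding k_def by blast+
  have min: "run G (take i w) (u, []) \<noteq> Some (u, [])" if "1 \<le> i" "i < k" for i
    using not_less_Least[of i "\<lambda>k. 1 \<le> k \<and> k \<le> length w \<and> run G (take k w) (u, []) = Some (u, [])"]
      that k unfolding k_def[symmetric] by auto
  have wl: "w \<in> lists (alphabet G)" using w by (simp add: up_words_def)
  have "take k w \<in> markov_dyck_code G u"
    using k min wl w by (auto simp: code_iff[OF u] min_def dest: in_set_takeD)
  moreover have "drop k w \<in> up_words G u v"
    using w k run_append[of G "take k w" "drop k w" "(u, [])"] wl
    by (auto simp: up_words_def dest: in_set_dropD)
  ultimately show ?thesis using that[of u "take k w" "drop k w"] u by (simp add: blocks_def)
next
  case False
  obtain x w' where xw: "w = x # w'" using w by (cases w) auto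
  have rd: "run G w (u, []) \<noteq> None" and wl: "w \<in> lists (alphabet G)"
    using w by (auto simp: up_words_def)
  obtain e where e: "x = Neg e" "tail G e = u" "e \<in> arcs G"
    using run_empty_stack_hd[of G x w' u] rd wl xw by auto
  \<comment> \<open>the pushed arc is never popped again, so it can be removed from the bottom\<close>
  have stay: "\<exists>v' st'. run G (take k w') (head G e, [e]) = Some (v', st' @ [e]) \<and>
      run G (take k w') (head G e, []) = Some (v', st')" if "k \<le> length w'" for k
    using that
  proof (induction k)
    case 0
    show ?case by simp
  next
    case (Suc k)
    then obtain v' st' where h: "run G (take k w') (head G e, [e]) = Some (v', st' @ [e])"
      "run G (take k w') (head G e, []) = Some (v', st')" by auto
    have tk: "take (Suc k) w' = take k w' @ [w' ! k]"
      using Suc.prems by (simp add: take_Suc_conv_app_nth)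
    have "run G (take (Suc (Suc k)) w) (u, []) \<noteq> None" by (rule run_take_defined[OF rd])
    then have s: "step G (w' ! k) (v', st' @ [e]) \<noteq> None"
      using xw e h by (auto simp: tk run_append bind_eq_Some_conv)
    show ?case
    \<comment> \<open>popping now would remove the first arc and so return to the empty stack\<close>
    proof (cases "\<exists>g. w' ! k = Pos g \<and> st' = []")
      case True
      then have "run G (take (Suc (Suc k)) w) (u, []) = Some (u, [])"
        using xw e h s by (auto simp: tk run_append split: if_splits)
      moreover have "Suc (Suc k) \<le> length w" using Suc.prems xw by simp
      ultimately show ?thesis using False by (metis Suc_le_mono le0 One_nat_def)
    next
      case nb: False
      have "step G (w' ! k) (v', st') \<noteq> None"
        using s nb by (cases "(G, w' ! k, (v', st'))" rule: step.cases) (auto split: if_splits)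
      then obtain v2 st2 where "step G (w' ! k) (v', st') = Some (v2, st2)" by auto
      with step_append_stack[OF this, of "[e]"] h show ?thesis by (auto simp: tk run_append)
    qed
  qed
  have "w' \<in> up_words G (head G e) v"
    using stay[of "length w'"] w xw e by (auto simp: up_words_def)
  moreover have "[x] \<in> blocks G u (head G e)" using e by (auto simp: blocks_def)
  ultimately show ?thesis using that[of "head G e" "[x]" w'] e xw by (simp add: head_in_verts)
qed

end

lemma Nil_in_up_words: "[] \<in> up_words G u v \<longleftrightarrow> u = v"
  by (auto simp: up_words_def)

section \<open>Generating functions of words with unique factorization\<close>

lemma finite_length_slice:
  assumes "finite A" "L \<subseteq> lists A"
  shows "finite {w \<in> L. length w = n}"
  by (rule finite_subset[OF _ finite_lists_length_eq[OF assms(1), of n]]) (use assms in auto)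

text \<open>
  With \<open>f = 1\<close> this gives the product of the two generating functions; with \<open>f i = i\<close> the first factor
  is replaced by its derivative times $z$, which counts its words with a marked position.
\<close>

lemma sum_over_factor_pairs:
  fixes f :: "nat \<Rightarrow> real"
  assumes "finite A" "B \<subseteq> lists A" "L \<subseteq> lists A"
  shows "finite {(b, w). b \<in> B \<and> w \<in> L \<and> length b + length w = n}" (is "finite ?S")
    and "(\<Sum>(b, w)\<in>{(b, w). b \<in> B \<and> w \<in> L \<and> length b + length w = n}. f (length b)) =
      (\<Sum>i = 0..n. f i * fps_nth (gen_fun B) i * fps_nth (gen_fun L) (n - i))"
proof -
  define T where "T i = {b \<in> B. length b = i} \<times> {w \<in> L. length w = n - i}" for i
  have fT: "finite (T i)" for i
    unfolding T_def using finite_length_slice[OF assms(1,2)] finite_length_slice[OF assms(1,3)] by simp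
  have S: "?S = (\<Union>i\<in>{0..n}. T i)" by (auto simp: T_def)
  show "finite ?S" unfolding S using fT by simp
  have "(\<Sum>(b, w)\<in>?S. f (length b)) = (\<Sum>i = 0..n. \<Sum>(b, w)\<in>T i. f (length b))"
    unfolding S by (rule sum.UNION_disjoint) (use fT in \<open>auto simp: T_def\<close>)
  also have "\<dots> = (\<Sum>i = 0..n. f i * fps_nth (gen_fun B) i * fps_nth (gen_fun L) (n - i))"
  proof (rule sum.cong[OF HOL.refl])
    fix i
    have "(\<Sum>(b, w)\<in>T i. f (length b)) = (\<Sum>_\<in>T i. f i)" by (rule sum.cong) (auto simp: T_def)
    then show "(\<Sum>(b, w)\<in>T i. f (length b)) = f i * fps_nth (gen_fun B) i * fps_nth (gen_fun L) (n - i)"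
      by (simp add: T_def card_cartesian_product gen_fun_def)
  qed
  finally show "(\<Sum>(b, w)\<in>?S. f (length b)) =
      (\<Sum>i = 0..n. f i * fps_nth (gen_fun B) i * fps_nth (gen_fun L) (n - i))" .
qed

lemma card_factor_pairs:
  assumes "finite A" "B \<subseteq> lists A" "L \<subseteq> lists A"
  shows "real (card {(b, w). b \<in> B \<and> w \<in> L \<and> length b + length w = n}) =
    fps_nth (gen_fun B * gen_fun L) n"
  using sum_over_factor_pairs(2)[OF assms, of "\<lambda>_. 1" n] by (simp add: fps_mult_nth case_prod_beta)

definition marked_pairs :: "'a list set \<Rightarrow> 'a list set \<Rightarrow> nat \<Rightarrow> (('a list \<times> 'a list) \<times> nat) set" where
  "marked_pairs B L n = {((b, w), j). b \<in> B \<and> w \<in> L \<and> length b + length w = n \<and> j < length b}"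

lemma card_marked_pairs:
  assumes "finite A" "B \<subseteq> lists A" "L \<subseteq> lists A"
  shows "finite (marked_pairs B L n)"
    and "real (card (marked_pairs B L n)) = fps_nth (fps_X * fps_deriv (gen_fun B) * gen_fun L) n"
proof -
  define S where "S = {(b, w). b \<in> B \<and> w \<in> L \<and> length b + length w = n}"
  note S = sum_over_factor_pairs(1)[OF assms, of n, folded S_def]
    sum_over_factor_pairs(2)[OF assms, of real n, folded S_def]
  have m: "marked_pairs B L n = (SIGMA q:S. {..<length (fst q)})"
    by (auto simp: marked_pairs_def S_def)
  show "finite (marked_pairs B L n)" unfolding m using S(1) by simp
  have "real (card (marked_pairs B L n)) = (\<Sum>(b, w)\<in>S. real (length b))"
    unfolding m using S(1) by (simp add: case_prod_beta)
  also have "\<dots> = fps_nth (fps_X * fps_deriv (gen_fun B) * gen_fun L) n"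
    unfolding S(2) fps_mult_nth[of "fps_X * fps_deriv (gen_fun B)"]
    by (intro sum.cong HOL.refl) auto
  finally show "real (card (marked_pairs B L n)) = fps_nth (fps_X * fps_deriv (gen_fun B) * gen_fun L) n" .
qed

lemma gen_fun_nth_0: "[] \<notin> L \<Longrightarrow> fps_nth (gen_fun L) 0 = 0"
  by (auto simp: gen_fun_def)

context fin_digraph
begin

lemma finite_alphabet: "finite (alphabet G)"
  by (simp add: alphabet_def)

lemma up_words_alphabet: "up_words G u v \<subseteq> lists (alphabet G)"
  by (auto simp: up_words_def)

lemma dyck_closed_alphabet: "dyck_closed G u \<subseteq> lists (alphabet G)"
  by (auto simp: dyck_closed_def)

lemma code_alphabet: "markov_dyck_code G u \<subseteq> lists (alphabet G)"
  by (auto simp: markov_dyck_code_def)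

lemma blocks_alphabet: "blocks G u v \<subseteq> lists (alphabet G)"
  using code_alphabet by (auto simp: blocks_def split: if_splits)

lemma gen_fun_blocks:
  assumes u: "u \<in> verts G"
  shows "gen_fun (blocks G u v) = (if u = v then gen_fun (markov_dyck_code G u) else 0) +
    fps_X * of_nat (card {e \<in> arcs G. tail G e = u \<and> head G e = v})"
proof (rule fps_ext)
  fix n
  define C where "C = (if u = v then markov_dyck_code G u else {})"
  define N :: "('a, 'b) gen list set" where "N = {[Neg e] | e. e \<in> arcs G \<and> tail G e = u \<and> head G e = v}"
  have len: "length c \<noteq> 1" if "c \<in> C" for c
  proof
    assume "length c = 1"
    then obtain x where x: "c = [x]" by (auto simp: length_Suc_conv)
    have c: "c \<in> markov_dyck_code G u" using that by (auto simp: C_def split: if_splits)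
    then show False using x
      by (cases x) (auto simp: code_iff[OF u] split: if_splits)
  qed
  have Nim: "N = (\<lambda>e. [Neg e]) ` {e \<in> arcs G. tail G e = u \<and> head G e = v}" by (auto simp: N_def)
  have fC: "finite {w \<in> C. length w = n}"
    by (rule finite_length_slice[OF finite_alphabet]) (use code_alphabet in \<open>auto simp: C_def\<close>)
  have "{w \<in> blocks G u v. length w = n} = {w \<in> C. length w = n} \<union> {w \<in> N. length w = n}"
    by (auto simp: blocks_def C_def N_def)
  moreover have "{w \<in> C. length w = n} \<inter> {w \<in> N. length w = n} = {}"
    by (auto simp: N_def dest: len)
  moreover have "finite N" unfolding Nim by simp
  ultimately have "card {w \<in> blocks G u v. length w = n} =
      card {w \<in> C. length w = n} + card {w \<in> N. length w = n}"
    using fC by (simp add: card_Un_disjoint)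
  moreover have "{w \<in> N. length w = n} = (if n = 1 then N else {})" by (auto simp: N_def)
  moreover have "card N = card {e \<in> arcs G. tail G e = u \<and> head G e = v}"
    unfolding Nim by (rule card_image) (auto simp: inj_on_def)
  ultimately show "fps_nth (gen_fun (blocks G u v)) n =
    fps_nth ((if u = v then gen_fun (markov_dyck_code G u) else 0) +
      fps_X * of_nat (card {e \<in> arcs G. tail G e = u \<and> head G e = v})) n"
    by (auto simp: gen_fun_def C_def)
qed

text \<open>
  Split off the first block: this is the matrix identity \<open>S = 1 + H S\<close>.
\<close>

lemma gen_fun_up_words:
  assumes u: "u \<in> verts G"
  shows "gen_fun (up_words G u v) = (if u = v then 1 else 0) +
    (\<Sum>t\<in>verts G. gen_fun (blocks G u t) * gen_fun (up_words G t v))"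
proof (rule fps_ext)
  fix n
  define P where "P t = {(b, w). b \<in> blocks G u t \<and> w \<in> up_words G t v \<and> length b + length w = n}" for t
  have fP: "finite (P t)" for t
    unfolding P_def by (rule sum_over_factor_pairs(1)[OF finite_alphabet blocks_alphabet up_words_alphabet])
  define W where "W = {w \<in> up_words G u v. length w = n}"
  have fW: "finite W" unfolding W_def by (rule finite_length_slice[OF finite_alphabet up_words_alphabet])
  have "bij_betw (\<lambda>(t, b, w). b @ w) (SIGMA t:verts G. P t) (W - {[]})"
    unfolding bij_betw_def
  proof
    show "inj_on (\<lambda>(t, b, w). b @ w) (SIGMA t:verts G. P t)"
      using block_factorization_unique[OF u] by (auto simp: inj_on_def P_def)
    show "(\<lambda>(t, b, w). b @ w) ` (SIGMA t:verts G. P t) = W - {[]}"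
    proof
      show "(\<lambda>(t, b, w). b @ w) ` (SIGMA t:verts G. P t) \<subseteq> W - {[]}"
        using up_words_append[OF blocks_up[OF u]] Nil_notin_blocks by (auto simp: P_def W_def)
      show "W - {[]} \<subseteq> (\<lambda>(t, b, w). b @ w) ` (SIGMA t:verts G. P t)"
      proof
        fix w assume w: "w \<in> W - {[]}"
        then obtain t b w' where "t \<in> verts G" "b \<in> blocks G u t" "w' \<in> up_words G t v" "w = b @ w'"
          using block_factorization_exists[OF u, of w v] by (auto simp: W_def)
        then show "w \<in> (\<lambda>(t, b, w). b @ w) ` (SIGMA t:verts G. P t)"
          using w by (intro image_eqI[of _ _ "(t, b, w')"]) (auto simp: P_def W_def)
      qed
    qed
  qed
  from bij_betw_same_card[OF this] have "card (W - {[]}) = (\<Sum>t\<in>verts G. card (P t))"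
    using fP by simp
  moreover have "real (card W) = real (card (W - {[]})) + (if n = 0 \<and> u = v then 1 else 0)"
    using fW card_Suc_Diff1[OF fW, of "[]"] Nil_in_up_words[of G u v] by (auto simp: W_def)
  ultimately have "real (card W) =
      (if n = 0 \<and> u = v then 1 else 0) + (\<Sum>t\<in>verts G. real (card (P t)))" by simp
  then show "fps_nth (gen_fun (up_words G u v)) n = fps_nth ((if u = v then 1 else 0) +
      (\<Sum>t\<in>verts G. gen_fun (blocks G u t) * gen_fun (up_words G t v))) n"
    unfolding P_def card_factor_pairs[OF finite_alphabet blocks_alphabet up_words_alphabet]
    by (simp add: gen_fun_def[of "up_words G u v"] W_def fps_sum_nth)
qed

lemma code_mult_closed:
  assumes u: "u \<in> verts G" and b: "b \<in> markov_dyck_code G u" and w: "w \<in> dyck_closed G u"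
  shows "b @ w \<in> dyck_closed G u"
  using b w by (auto simp: dyck_closed_def code_iff[OF u] run_append)

lemma closed_up: "dyck_closed G u \<subseteq> up_words G u u"
  by (auto simp: dyck_closed_def up_words_def)

lemma code_blocks: "markov_dyck_code G u \<subseteq> blocks G u u"
  by (auto simp: blocks_def)

text \<open>
  The first block of a word that ends with the empty stack is a code word, since an arc that is
  never popped would remain.
\<close>

lemma closed_factorization_exists:
  assumes u: "u \<in> verts G" and w: "w \<in> dyck_closed G u" "w \<noteq> []"
  obtains b w' where "b \<in> markov_dyck_code G u" "w' \<in> dyck_closed G u" "w = b @ w'"
proof -
  obtain t b w' where f: "b \<in> blocks G u t" "w' \<in> up_words G t u" "w = b @ w'"
    using block_factorization_exists[OF u, of w u] w closed_up by blast
  have "b \<in> markov_dyck_code G u"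
  proof (rule ccontr)
    assume "b \<notin> markov_dyck_code G u"
    then obtain e where e: "b = [Neg e]" "tail G e = u" "head G e = t"
      using f by (auto simp: blocks_def split: if_splits)
    obtain st where "run G w' (t, []) = Some (u, st)" using f by (auto simp: up_words_def)
    from run_append_stack[OF this, of "[e]"] show False
      using w f e by (auto simp: dyck_closed_def)
  qed
  moreover from this have "t = u" "w' \<in> dyck_closed G u"
    using f w blocks_up[OF u f(1)] by (auto simp: up_words_def dyck_closed_def code_iff[OF u] run_append)
  ultimately show ?thesis using f that by blast
qed

text \<open>
  The words with product $P_u$, together with the empty word, are the free monoid over the code of
  \<open>u\<close>; hence their generating function is the diagonal entry $1 / (1 - g)$ of $D^*$.
\<close>

lemma gen_fun_dyck_closed:
  assumes u: "u \<in> verts G"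
  shows "gen_fun (dyck_closed G u) = 1 + gen_fun (markov_dyck_code G u) * gen_fun (dyck_closed G u)"
proof (rule fps_ext)
  fix n
  define P where "P = {(b, w). b \<in> markov_dyck_code G u \<and> w \<in> dyck_closed G u \<and> length b + length w = n}"
  define W where "W = {w \<in> dyck_closed G u. length w = n}"
  have fW: "finite W" unfolding W_def by (rule finite_length_slice[OF finite_alphabet dyck_closed_alphabet])
  have "bij_betw (\<lambda>(b, w). b @ w) P (W - {[]})"
    unfolding bij_betw_def
  proof
    have "b = b' \<and> w = w'"
      if "b \<in> markov_dyck_code G u" "b' \<in> markov_dyck_code G u" "w \<in> dyck_closed G u"
        "w' \<in> dyck_closed G u" "b @ w = b' @ w'" for b b' w w'
      using block_factorization_unique[OF u, of b u b' u w u w' u] that code_blocks closed_up by blast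
    then show "inj_on (\<lambda>(b, w). b @ w) P"
      by (auto simp: inj_on_def P_def)
    show "(\<lambda>(b, w). b @ w) ` P = W - {[]}"
    proof
      show "(\<lambda>(b, w). b @ w) ` P \<subseteq> W - {[]}"
        using code_mult_closed[OF u] by (auto simp: P_def W_def markov_dyck_code_def)
      show "W - {[]} \<subseteq> (\<lambda>(b, w). b @ w) ` P"
      proof
        fix w assume w: "w \<in> W - {[]}"
        then obtain b w' where "b \<in> markov_dyck_code G u" "w' \<in> dyck_closed G u" "w = b @ w'"
          using closed_factorization_exists[OF u, of w] by (auto simp: W_def)
        then show "w \<in> (\<lambda>(b, w). b @ w) ` P"
          using w by (intro image_eqI[of _ _ "(b, w')"]) (auto simp: P_def W_def)
      qed
    qed
  qed
  from bij_betw_same_card[OF this] have "card (W - {[]}) = card P" by simp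
  moreover have "real (card W) = real (card (W - {[]})) + (if n = 0 then 1 else 0)"
    using fW card_Suc_Diff1[OF fW, of "[]"] by (auto simp: W_def dyck_closed_def)
  ultimately have "real (card W) = (if n = 0 then 1 else 0) + real (card P)" by simp
  then show "fps_nth (gen_fun (dyck_closed G u)) n =
      fps_nth (1 + gen_fun (markov_dyck_code G u) * gen_fun (dyck_closed G u)) n"
    unfolding P_def card_factor_pairs[OF finite_alphabet code_alphabet dyck_closed_alphabet]
    by (simp add: gen_fun_def[of "dyck_closed G u"] W_def)
qed

end

section \<open>Periodic sequences\<close>

lemma shift_funpow: "(shift ^^ n) x = (\<lambda>i. x (i + int n))"
  by (induction n arbitrary: x) (auto simp: shift_def funpow_swap1 add_ac fun_eq_iff)

definition periodic :: "nat \<Rightarrow> (int \<Rightarrow> 'a) \<Rightarrow> bool" where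
  "periodic n x \<longleftrightarrow> (\<forall>i. x (i + int n) = x i)"

lemma shift_funpow_fixed_iff: "(shift ^^ n) x = x \<longleftrightarrow> periodic n x"
  by (auto simp: shift_funpow periodic_def fun_eq_iff)

lemma periodic_mult: "periodic n x \<Longrightarrow> x (i + int k * int n) = x i"
proof (induction k)
  case (Suc k)
  have "x (i + int (Suc k) * int n) = x ((i + int k * int n) + int n)" by (simp add: algebra_simps)
  also have "\<dots> = x (i + int k * int n)" using Suc.prems unfolding periodic_def by blast
  also have "\<dots> = x i" using Suc by blast
  finally show ?case .
qed simp

lemma periodic_add_mult: "periodic n x \<Longrightarrow> x (i + k * int n) = x i"
proof (cases "k \<ge> 0")
  case True
  assume "periodic n x"
  then show ?thesis using periodic_mult[of n x i "nat k"] True by simp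
next
  case False
  assume "periodic n x"
  then show ?thesis using periodic_mult[of n x "i + k * int n" "nat (- k)"] False by simp
qed

lemma subword_periodic: "periodic n x \<Longrightarrow> subword x (i + k * int n) m = subword x i m"
  using periodic_add_mult[of n x _ k] by (simp add: subword_def algebra_simps) (metis add.assoc add.commute)

lemma length_subword [simp]: "length (subword x i m) = m"
  by (simp add: subword_def)

lemma nth_subword: "k < m \<Longrightarrow> subword x i m ! k = x (i + int k)"
  by (simp add: subword_def)

lemma take_subword: "k \<le> m \<Longrightarrow> take k (subword x i m) = subword x i k"
  by (rule nth_equalityI) (auto simp: nth_subword)

lemma drop_subword: "k \<le> m \<Longrightarrow> drop k (subword x i m) = subword x (i + int k) (m - k)"
  by (rule nth_equalityI) (auto simp: nth_subword algebra_simps)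

lemma subword_multiple:
  assumes "periodic n x"
  shows "subword x i (k * n) = concat (replicate k (subword x i n))"
proof (induction k)
  case 0
  show ?case by (simp add: subword_def)
next
  case (Suc k)
  have "subword x i (Suc k * n) = subword x i n @ subword x (i + 1 * int n) (k * n)"
    using subword_add[of x i n "k * n"] by simp
  then show ?case using Suc subword_periodic[OF assms, of i 1] by simp
qed

definition cyclic_word :: "'a list \<Rightarrow> int \<Rightarrow> 'a" where
  "cyclic_word w i = w ! nat (i mod int (length w))"

lemma periodic_cyclic_word: "periodic (length w) (cyclic_word w)"
  by (simp add: periodic_def cyclic_word_def)

lemma subword_cyclic_word: "subword (cyclic_word w) 0 (length w) = w"
  by (rule nth_equalityI) (auto simp: nth_subword cyclic_word_def)

lemma cyclic_word_subword:
  assumes "periodic n x" "n > 0"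
  shows "cyclic_word (subword x i n) k = x (i + k)"
proof -
  have "cyclic_word (subword x i n) k = x (i + k mod int n)"
    using assms(2) by (simp add: cyclic_word_def nth_subword nat_less_iff)
  also have "\<dots> = x (i + k)"
    using periodic_add_mult[OF assms(1), of "i + k mod int n" "k div int n"]
    by (simp add: algebra_simps)
  finally show ?thesis .
qed

section \<open>Heights, boundaries and drift\<close>

primrec letter_height :: "('v, 'e) gen \<Rightarrow> int" where
  "letter_height Zero = 0"
| "letter_height (Vert v) = 0"
| "letter_height (Neg e) = 1"
| "letter_height (Pos e) = - 1"

definition height :: "('v, 'e) gen list \<Rightarrow> int" where
  "height w = sum_list (map letter_height w)"

lemma height_simps [simp]:
  "height [] = 0" "height (x # w) = letter_height x + height w" "height (w @ w') = height w + height w'"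
  by (simp_all add: height_def)

lemma step_height:
  "step G x (u, st) = Some (v, st') \<Longrightarrow> int (length st') = int (length st) + letter_height x"
  by (cases "(G, x, (u, st))" rule: step.cases) (auto split: if_splits)

lemma run_height:
  "run G w (u, st) = Some (v, st') \<Longrightarrow> int (length st') = int (length st) + height w"
proof (induction w arbitrary: u st)
  case (Cons x w)
  then obtain u1 st1 where 1: "step G x (u, st) = Some (u1, st1)" "run G w (u1, st1) = Some (v, st')"
    by (auto simp: bind_eq_Some_conv)
  show ?case using Cons.IH[OF 1(2)] step_height[OF 1(1)] by simp
qed auto

text \<open>
  If no prefix has a height below minus the size of \<open>st\<close>, then no arc below \<open>st\<close> is ever popped.
\<close>

lemma run_drop_stack_bottom:
  assumes "run G w (u, st @ t) \<noteq> None"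
    and "\<And>k. k \<le> length w \<Longrightarrow> int (length st) + height (take k w) \<ge> 0"
  shows "run G w (u, st) \<noteq> None"
  using assms
proof (induction w arbitrary: u st)
  case (Cons x w)
  have pre: "int (length st) + letter_height x + height (take k w) \<ge> 0" if "k \<le> length w" for k
    using Cons.prems(2)[of "Suc k"] that by simp
  show ?case
  proof (cases x)
    case (Neg e)
    then show ?thesis
      using Cons.prems(1) Cons.IH[of "head G e" "e # st"] pre
      by (auto simp: add_ac simp del: not_None_eq split: if_splits)
  next
    case (Pos e)
    have "st \<noteq> []" using pre[of 0] Pos by auto
    then obtain f st' where st: "st = f # st'" by (cases st) auto
    then show ?thesis
      using Cons.prems(1) Cons.IH[of "tail G e" st'] pre Pos
      by (auto simp: add_ac simp del: not_None_eq split: if_splits)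
  next
    case (Vert a)
    then show ?thesis
      using Cons.prems(1) Cons.IH[of u st] pre
      by (auto simp: add_ac simp del: not_None_eq split: if_splits)
  qed (use Cons.prems(1) in auto)
qed simp

lemma run_concat_replicate:
  "run G w (u, []) = Some (u, st) \<Longrightarrow> run G (concat (replicate k w)) (u, t) \<noteq> None"
proof (induction k arbitrary: t)
  case (Suc k)
  have "run G w (u, t) = Some (u, st @ t)" using run_append_stack[OF Suc.prems, of t] by simp
  then show ?case using Suc by (simp add: run_append del: not_None_eq)
qed simp

text \<open>
  After position \<open>i\<close> nothing is popped that was pushed before \<open>i\<close>.  For \<open>m > 0\<close> the only possible
  \<open>u\<close> is the source of \<open>x i\<close>, so it is the same for all of these \<open>m\<close>.
\<close>

definition boundary :: "('v, 'e) pre_digraph \<Rightarrow> (int \<Rightarrow> ('v, 'e) gen) \<Rightarrow> int \<Rightarrow> bool" where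
  "boundary G x i \<longleftrightarrow> (\<forall>m. \<exists>u. run G (subword x i m) (u, []) \<noteq> None)"

text \<open>
  Two periods force the block path to close up: the second period starts at the source of the
  first letter, and so the first one has to end there.
\<close>

lemma boundary_iff:
  assumes p: "periodic n x" "n > 0" and al: "\<And>i. x i \<in> alphabet G"
  shows "boundary G x i \<longleftrightarrow> (\<exists>u. subword x i n \<in> up_words G u u)"
proof
  assume "boundary G x i"
  then obtain u where "run G (subword x i (2 * n)) (u, []) \<noteq> None" unfolding boundary_def by blast
  moreover have "subword x i (2 * n) = subword x i n @ subword x i n"
    using subword_multiple[OF p(1), of i 2] by (simp add: numeral_2_eq_2)
  ultimately have r2: "run G (subword x i n @ subword x i n) (u, []) \<noteq> None" by simp
  then obtain v st where r: "run G (subword x i n) (u, []) = Some (v, st)"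
    "run G (subword x i n) (v, st) \<noteq> None"
    by (auto simp: run_append bind_eq_Some_conv)
  obtain y w where yw: "subword x i n = y # w" using p by (cases "subword x i n")
    (auto dest: arg_cong[of _ _ length])
  have "y = x i" using nth_subword[of 0 n x i] p yw by simp
  then have "y \<in> alphabet G" using al by simp
  then obtain e where "y = Neg e" "tail G e = u"
    using run_empty_stack_hd[of G y w u] r(1) yw by auto
  then have "v = u" using r(2) yw by (auto split: if_splits)
  then show "\<exists>u. subword x i n \<in> up_words G u u"
    using r al by (auto simp: up_words_def subword_def)
next
  assume "\<exists>u. subword x i n \<in> up_words G u u"
  then obtain u st where r: "run G (subword x i n) (u, []) = Some (u, st)" by (auto simp: up_words_def)
  show "boundary G x i"
    unfolding boundary_def
  proof
    fix m
    have "run G (subword x i (m * n)) (u, []) \<noteq> None"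
      unfolding subword_multiple[OF p(1)] by (rule run_concat_replicate[OF r])
    from run_take_defined[OF this, of m]
    have "run G (subword x i m) (u, []) \<noteq> None" using p by (simp add: take_subword del: not_None_eq)
    then show "\<exists>u. run G (subword x i m) (u, []) \<noteq> None" by blast
  qed
qed

context wf_digraph
begin

text \<open>
  For the empty word the condition is trivial, so it may be stated for all lengths.
\<close>

lemma markov_dyck_shift_iff:
  "x \<in> markov_dyck_shift G \<longleftrightarrow>
    (\<forall>i. x i \<in> alphabet G) \<and> (\<forall>i m. \<exists>s. run G (subword x i m) s \<noteq> None)"
proof -
  have dw: "w \<in> dyck_words G \<longleftrightarrow> w \<in> lists (alphabet G) \<and> (\<exists>s. run G w s \<noteq> None)" if "w \<noteq> []" for w
    using that nonzero_iff_run[OF wf_digraph_axioms, of w] by (auto simp: dyck_words_def simp del: not_None_eq)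
  have ne: "subword x i m \<noteq> []" if "0 < m" for i m
    using that by (metis length_subword length_greater_0_conv)
  show ?thesis
  proof
    assume "x \<in> markov_dyck_shift G"
    then have h: "subword x i m \<in> lists (alphabet G) \<and> (\<exists>s. run G (subword x i m) s \<noteq> None)" if "0 < m" for i m
      using that dw[OF ne[OF that]] by (simp add: markov_dyck_shift_def subshift_of_def)
    have "x i \<in> alphabet G" for i
      using h[of 1 i] by (simp add: subword_def)
    moreover have "\<exists>s. run G (subword x i m) s \<noteq> None" for i m
      using h[of m i] by (cases "m = 0") (auto simp: subword_def)
    ultimately show "(\<forall>i. x i \<in> alphabet G) \<and> (\<forall>i m. \<exists>s. run G (subword x i m) s \<noteq> None)" by blast
  next
    assume h: "(\<forall>i. x i \<in> alphabet G) \<and> (\<forall>i m. \<exists>s. run G (subword x i m) s \<noteq> None)"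
    have "subword x i m \<in> lists (alphabet G)" for i m using h by (auto simp: subword_def)
    then have "subword x i m \<in> dyck_words G" if "0 < m" for i m
      using h dw[OF ne[OF that], of i] by blast
    then show "x \<in> markov_dyck_shift G" by (simp add: markov_dyck_shift_def subshift_of_def)
  qed
qed

text \<open>
  Up to a multiple of the period, every window lies in a window that starts at the boundary.
\<close>

lemma boundary_in_shift:
  assumes p: "periodic n x" "n > 0" and al: "\<And>i. x i \<in> alphabet G" and b: "boundary G x i"
  shows "x \<in> markov_dyck_shift G"
  unfolding markov_dyck_shift_iff
proof (intro conjI allI)
  fix j m
  define k where "k = nat ((j - i) mod int n)"
  have k: "int k = (j - i) mod int n" using p(2) by (simp add: k_def)
  obtain u where u: "run G (subword x i (k + m)) (u, []) \<noteq> None"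
    using b unfolding boundary_def by blast
  have "run G (subword x (i + int k) m) (the (run G (subword x i k) (u, []))) \<noteq> None"
    using u by (cases "run G (subword x i k) (u, [])") (auto simp: subword_add run_append)
  moreover have "subword x j m = subword x (i + int k) m"
    using subword_periodic[OF p(1), of "i + int k" "(j - i) div int n" m] k
    by (simp add: algebra_simps)
  ultimately show "\<exists>s. run G (subword x j m) s \<noteq> None" by metis
qed (rule al)

end

definition drift :: "nat \<Rightarrow> (int \<Rightarrow> ('v, 'e) gen) \<Rightarrow> int" where
  "drift n x = height (subword x 0 n)"

text \<open>
  Moving the window by one position removes and adds the same letter.
\<close>

lemma height_subword_periodic:
  assumes "periodic n x"
  shows "height (subword x i n) = drift n x"
proof -
  have s: "height (subword x (i + 1) n) = height (subword x i n)" for i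
  proof -
    have "height (subword x i (1 + n)) = height (subword x i (n + 1))" by (simp add: add.commute)
    then show ?thesis
      unfolding subword_add using assms by (simp add: subword_def periodic_def)
  qed
  show ?thesis
    unfolding drift_def
  proof (induction i rule: int_induct[where k = 0])
    case (step1 i)
    then show ?case using s[of i] by simp
  next
    case (step2 i)
    then show ?case using s[of "i - 1"] by simp
  qed simp
qed

context wf_digraph
begin

lemma boundary_exists:
  assumes p: "periodic n x" "n > 0" and x: "x \<in> markov_dyck_shift G" and d: "drift n x \<ge> 0"
  obtains i where "boundary G x i"
proof -
  define h where "h k = height (subword x 0 k)" for k
  have h_add: "h (k + m) = h k + height (subword x (int k) m)" for k m
    by (simp add: h_def subword_add)
  \<comment> \<open>a lowest point within one period is a lowest point among all later ones\<close>
  have "Min (h ` {..<n}) \<in> h ` {..<n}" using p(2) by (intro Min_in) auto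
  then obtain k0 where "h k0 = Min (h ` {..<n})" by force
  then have k0: "h k0 \<le> h k" if "k < n" for k using that by simp
  have low: "h k0 \<le> h k" for k
  proof (induction k rule: less_induct)
    case (less k)
    show ?case
    proof (cases "k < n")
      case False
      then have "h k = h (k - n) + drift n x"
        using h_add[of "k - n" n] height_subword_periodic[OF p(1)] by simp
      then show ?thesis using less[of "k - n"] False p(2) d by simp
    qed (rule k0)
  qed
  have "boundary G x (int k0)"
    unfolding boundary_def
  proof
    fix m
    obtain u st where r: "run G (subword x (int k0) m) (u, st) \<noteq> None"
      using x unfolding markov_dyck_shift_iff by (metis surj_pair)
    have "run G (subword x (int k0) m) (u, []) \<noteq> None"
    proof (rule run_drop_stack_bottom)
      show "run G (subword x (int k0) m) (u, [] @ st) \<noteq> None" using r by simp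
      fix k assume "k \<le> length (subword x (int k0) m)"
      then have "height (take k (subword x (int k0) m)) = h (k0 + k) - h k0"
        using h_add[of k0 k] by (simp add: take_subword)
      then show "int (length []) + height (take k (subword x (int k0) m)) \<ge> 0" using low[of "k0 + k"] by simp
    qed
    then show "\<exists>u. run G (subword x (int k0) m) (u, []) \<noteq> None" by blast
  qed
  then show ?thesis by (rule that)
qed

end

section \<open>Counting the periodic points of nonnegative drift\<close>

definition periodic_points :: "('v, 'e) pre_digraph \<Rightarrow> nat \<Rightarrow> (int \<Rightarrow> ('v, 'e) gen) set" where
  "periodic_points G n = {x \<in> markov_dyck_shift G. periodic n x}"

lemma num_periodic_eq: "num_periodic (markov_dyck_shift G) n = card (periodic_points G n)"
  by (simp add: num_periodic_def periodic_points_def shift_funpow_fixed_iff)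

text \<open>
  Closed block paths of total length \<open>n\<close> with a marked position \<open>j\<close>.  Marking only positions in the
  first block \<open>b\<close> makes every periodic point of drift $\geq 0$ arise exactly once.
\<close>

definition rooted_points ::
    "('v, 'e) pre_digraph \<Rightarrow> nat \<Rightarrow> ('v \<times> 'v \<times> (('v, 'e) gen list \<times> ('v, 'e) gen list) \<times> nat) set" where
  "rooted_points G n =
    (SIGMA u:verts G. SIGMA t:verts G. marked_pairs (blocks G u t) (up_words G t u) n)"

text \<open>
  The periodic point that reads the closed path with the marked position at \<open>0\<close>; the path then
  starts at position \<open>- j\<close>.
\<close>

definition unroot :: "'v \<times> 'v \<times> ('a list \<times> 'a list) \<times> nat \<Rightarrow> int \<Rightarrow> 'a" where
  "unroot = (\<lambda>(u, t, (b, w), j). \<lambda>i. cyclic_word (b @ w) (i + int j))"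

lemma unroot_simps: "unroot (u, t, (b, w), j) = (\<lambda>i. cyclic_word (b @ w) (i + int j))"
  by (simp add: unroot_def)

lemma periodic_unroot: "length b + length w = n \<Longrightarrow> periodic n (unroot (u, t, (b, w), j))"
proof -
  assume n: "length b + length w = n"
  have "cyclic_word (b @ w) (i + int n + int j) = cyclic_word (b @ w) (i + int j)" for i
    using periodic_add_mult[OF periodic_cyclic_word[of "b @ w"], of "i + int j" 1] n
    by (simp add: algebra_simps)
  then show ?thesis by (simp add: unroot_simps periodic_def)
qed

lemma subword_unroot:
  "length b + length w = n \<Longrightarrow> subword (unroot (u, t, (b, w), j)) (- int j) n = b @ w"
  using subword_cyclic_word[of "b @ w"] by (simp add: unroot_simps subword_def algebra_simps)

context wf_digraph
begin

text \<open>
  The rotation of the closed path by its first block is again a closed path, so the end of the block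
  is a boundary; a position inside the block is followed by a proper suffix of a code word, which pops
  too much.
\<close>

lemma block_boundaries:
  assumes ut: "u \<in> verts G" "t \<in> verts G" and b: "b \<in> blocks G u t" and w: "w \<in> up_words G t u"
    and p: "periodic n x" and al: "\<And>i. x i \<in> alphabet G"
    and sw: "subword x i n = b @ w" and n: "n = length b + length w"
  shows "boundary G x i" "boundary G x (i + int (length b))"
    and "\<And>k. 1 \<le> k \<Longrightarrow> k < length b \<Longrightarrow> \<not> boundary G x (i + int k)"
proof -
  have n0: "n > 0" using Nil_notin_blocks[of u t] b n by (cases b) auto
  note bi = boundary_iff[OF p n0 al]
  show "boundary G x i"
    unfolding bi sw using up_words_append[OF blocks_up[OF ut(1) b] w] by blast
  have "subword x (i + int (length b)) n =
      subword x (i + int (length b)) (length w) @ subword x (i + int n) (length b)"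
    using subword_add[of x "i + int (length b)" "length w" "length b"] n by (simp add: add_ac)
  also have "subword x (i + int (length b)) (length w) = w"
    using drop_subword[of "length b" n x i] sw n by simp
  also have "subword x (i + int n) (length b) = b"
    using subword_periodic[OF p, of i 1 "length b"] take_subword[of "length b" n x i] sw n by simp
  finally show "boundary G x (i + int (length b))"
    unfolding bi using up_words_append[OF w blocks_up[OF ut(1) b]] by auto
  fix k assume k: "1 \<le> k" "k < length b"
  then have c: "b \<in> markov_dyck_code G u" using b by (auto simp: blocks_def split: if_splits)
  have "drop k b = subword x (i + int k) (length b - k)"
    using drop_subword[of k "length b" x i] take_subword[of "length b" n x i] sw n k by simp
  then show "\<not> boundary G x (i + int k)"
    using code_suffix_dips[OF ut(1) c k] unfolding boundary_def by metis
qed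

lemma rooted_pointsD:
  assumes "(u, t, (b, w), j) \<in> rooted_points G n"
  shows "u \<in> verts G" "t \<in> verts G" "b \<in> blocks G u t" "w \<in> up_words G t u"
    "n = length b + length w" "j < length b"
  using assms by (auto simp: rooted_points_def marked_pairs_def)

end

context fin_digraph
begin

lemma unroot_alphabet:
  assumes "(u, t, (b, w), j) \<in> rooted_points G n"
  shows "unroot (u, t, (b, w), j) i \<in> alphabet G"
proof -
  note r = rooted_pointsD[OF assms]
  have "b @ w \<in> lists (alphabet G)" using r blocks_alphabet up_words_alphabet by fastforce
  moreover have "unroot (u, t, (b, w), j) i \<in> set (b @ w)"
    unfolding unroot_simps cyclic_word_def by (rule nth_mem) (use r in \<open>simp add: nat_less_iff\<close>)
  ultimately show ?thesis by auto
qed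

lemma unroot_boundaries:
  assumes q: "(u, t, (b, w), j) \<in> rooted_points G n"
  defines "x \<equiv> unroot (u, t, (b, w), j)"
  shows "boundary G x (- int j)" "\<And>j'. j' < j \<Longrightarrow> \<not> boundary G x (- int j')"
proof -
  note r = rooted_pointsD[OF q]
  note bb = block_boundaries[OF r(1-4) periodic_unroot[OF r(5)[symmetric]] unroot_alphabet[OF q]
      subword_unroot[OF r(5)[symmetric]] r(5)]
  show "boundary G x (- int j)" unfolding x_def by (rule bb(1))
  fix j' assume "j' < j"
  then show "\<not> boundary G x (- int j')"
    using bb(3)[of "j - j'"] r(6) unfolding x_def by (simp add: of_nat_diff)
qed

text \<open>
  The marked position can be read off from the point, since \<open>- j\<close> is its last boundary up to \<open>0\<close>.
  One period from there on is the closed path, whose first block is unique.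
\<close>

lemma unroot_inj: "inj_on unroot (rooted_points G n)"
proof (rule inj_onI)
  fix q q' assume q: "q \<in> rooted_points G n" "q' \<in> rooted_points G n" "unroot q = unroot q'"
  obtain u t b w j where q1: "q = (u, t, (b, w), j)" by (metis surj_pair)
  obtain u' t' b' w' j' where q2: "q' = (u', t', (b', w'), j')" by (metis surj_pair)
  note d1 = rooted_pointsD[OF q(1)[unfolded q1]] and d2 = rooted_pointsD[OF q(2)[unfolded q2]]
  note b1 = unroot_boundaries[OF q(1)[unfolded q1]] and b2 = unroot_boundaries[OF q(2)[unfolded q2]]
  have e: "unroot (u, t, (b, w), j) = unroot (u', t', (b', w'), j')" using q q1 q2 by simp
  have j: "j = j'"
  proof (rule ccontr)
    assume "j \<noteq> j'"
    then consider "j < j'" | "j' < j" by linarith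
    then show False
    proof cases
      case 1
      show False using b2(2)[OF 1] b1(1) unfolding e by contradiction
    next
      case 2
      show False using b1(2)[OF 2] b2(1) unfolding e by contradiction
    qed
  qed
  have bw: "b @ w = b' @ w'"
    using subword_unroot[OF d1(5)[symmetric], of u t j] subword_unroot[OF d2(5)[symmetric], of u' t' j']
    by (metis e j)
  have src: "\<exists>e. hd (b @ w) = Neg e \<and> tail G e = u"
    if ub: "u \<in> verts G" "b \<in> blocks G u t" for u t b and w :: "('a, 'b) gen list"
  proof -
    obtain x v where b: "b = x # v" using ub Nil_notin_blocks[of u t] by (cases b) auto
    have "b \<in> up_words G u t" using blocks_up ub by blast
    then have "run G (x # v) (u, []) \<noteq> None" "x \<in> alphabet G" using b by (auto simp: up_words_def)
    then obtain e where "x = Neg e" "tail G e = u" by (rule run_empty_stack_hd)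
    then show ?thesis using b by simp
  qed
  have u: "u = u'" using src[OF d1(1,3), of w] src[OF d2(1,3), of w'] unfolding bw by auto
  show "q = q'"
    using block_factorization_unique[OF d1(1,3) d2(3)[folded u] d1(4) d2(4) bw] u j q1 q2 by simp
qed

text \<open>
  Conversely, a point of drift $\geq 0$ has a boundary, hence by periodicity one at or before \<open>0\<close>.
  The block that starts at the last of these contains position \<open>0\<close>.
\<close>

lemma unroot_image:
  assumes n: "n > 0"
  shows "unroot ` rooted_points G n = {x \<in> periodic_points G n. drift n x \<ge> 0}"
proof (intro Set.set_eqI iffI)
  fix x assume "x \<in> unroot ` rooted_points G n"
  then obtain q' where q': "q' \<in> rooted_points G n" "x = unroot q'" by blast
  obtain u t b w j where "q' = (u, t, (b, w), j)" by (metis surj_pair)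
  with q' have q: "(u, t, (b, w), j) \<in> rooted_points G n" and x: "x = unroot (u, t, (b, w), j)"
    by simp_all
  note r = rooted_pointsD[OF q]
  have p: "periodic n x" unfolding x by (rule periodic_unroot[OF r(5)[symmetric]])
  have "x \<in> markov_dyck_shift G"
    by (rule boundary_in_shift[OF p n])
      (use unroot_alphabet[OF q] unroot_boundaries(1)[OF q] x in auto)
  moreover have "drift n x \<ge> 0"
  proof -
    obtain st where "run G (b @ w) (u, []) = Some (u, st)"
      using up_words_append[OF blocks_up[OF r(1,3)] r(4)] by (auto simp: up_words_def)
    from run_height[OF this] show ?thesis
      using height_subword_periodic[OF p, of "- int j"] subword_unroot[OF r(5)[symmetric], of u t j] x
      by simp
  qed
  ultimately show "x \<in> {x \<in> periodic_points G n. drift n x \<ge> 0}" using p by (simp add: periodic_points_def)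
next
  fix x assume "x \<in> {x \<in> periodic_points G n. drift n x \<ge> 0}"
  then have x: "x \<in> markov_dyck_shift G" and p: "periodic n x" and d: "drift n x \<ge> 0"
    by (auto simp: periodic_points_def)
  have al: "x i \<in> alphabet G" for i using x by (simp add: markov_dyck_shift_iff)
  obtain i where i: "boundary G x i" using boundary_exists[OF p n x d] .
  \<comment> \<open>move the boundary to the left by enough periods\<close>
  have "\<exists>j. boundary G x (- int j)"
  proof (intro exI)
    have sh: "- int (nat (\<bar>i\<bar> * int n - i)) = i + (- \<bar>i\<bar>) * int n"
    proof -
      have "\<bar>i\<bar> * 1 \<le> \<bar>i\<bar> * int n" using n by (intro mult_left_mono) auto
      then have "i \<le> \<bar>i\<bar> * int n" using abs_ge_self[of i] by linarith
      then show ?thesis by simp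
    qed
    show "boundary G x (- int (nat (\<bar>i\<bar> * int n - i)))"
      using i unfolding boundary_def sh subword_periodic[OF p] .
  qed
  then obtain j where j: "boundary G x (- int j)" and min: "\<And>j'. j' < j \<Longrightarrow> \<not> boundary G x (- int j')"
    using exists_least_iff[of "\<lambda>j. boundary G x (- int j)"] by blast
  define w where "w = subword x (- int j) n"
  obtain u where u: "w \<in> up_words G u u"
    using j unfolding boundary_iff[OF p n al] w_def by blast
  have lw: "length w = n" by (simp add: w_def)
  obtain y v where yv: "w = y # v" using lw n by (cases w) auto
  have "run G (y # v) (u, []) \<noteq> None" "y \<in> alphabet G" using u yv by (auto simp: up_words_def)
  then obtain e where "tail G e = u" "e \<in> arcs G" by (rule run_empty_stack_hd)
  then have uv: "u \<in> verts G" by auto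
  have "w \<noteq> []" using yv by simp
  from block_factorization_exists[OF uv u this] obtain t b w' where
    f: "t \<in> verts G" "b \<in> blocks G u t" "w' \<in> up_words G t u" "w = b @ w'" .
  have nl: "n = length b + length w'" using f(4) lw by simp
  have b0: "length b > 0" using f Nil_notin_blocks[of u t] by (cases b) auto
  have bd: "boundary G x (- int j + int (length b))"
    by (rule block_boundaries(2)[OF uv f(1-3) p al _ nl]) (use f w_def in simp)
  have "j < length b"
  proof (rule ccontr)
    assume "\<not> j < length b"
    then have "j - length b < j" "- int (j - length b) = - int j + int (length b)"
      using b0 by linarith+
    then show False using bd min[of "j - length b"] by simp
  qed
  then have "(u, t, (b, w'), j) \<in> rooted_points G n"
    using uv f nl by (auto simp: rooted_points_def marked_pairs_def)
  moreover have "x = unroot (u, t, (b, w'), j)"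
    using cyclic_word_subword[OF p n, of "- int j"] f(4)
    by (auto simp: unroot_simps w_def[symmetric])
  ultimately show "x \<in> unroot ` rooted_points G n" by blast
qed

lemma finite_marked: "finite (marked_pairs (blocks G u t) (up_words G t u) n)"
  by (rule card_marked_pairs(1)[OF finite_alphabet blocks_alphabet up_words_alphabet])

lemma card_nonneg_drift:
  assumes "n > 0"
  shows "finite {x \<in> periodic_points G n. drift n x \<ge> 0}"
    and "real (card {x \<in> periodic_points G n. drift n x \<ge> 0}) =
      (\<Sum>u\<in>verts G. \<Sum>t\<in>verts G.
        fps_nth (fps_X * fps_deriv (gen_fun (blocks G u t)) * gen_fun (up_words G t u)) n)"
proof -
  have fin: "finite (rooted_points G n)"
    unfolding rooted_points_def using finite_marked by simp
  show "finite {x \<in> periodic_points G n. drift n x \<ge> 0}"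
    unfolding unroot_image[OF assms, symmetric] using fin by simp
  have "card {x \<in> periodic_points G n. drift n x \<ge> 0} = card (rooted_points G n)"
    unfolding unroot_image[OF assms, symmetric] by (rule card_image[OF unroot_inj])
  also have "\<dots> = (\<Sum>u\<in>verts G. \<Sum>t\<in>verts G. card (marked_pairs (blocks G u t) (up_words G t u) n))"
    unfolding rooted_points_def using finite_marked by simp
  finally show "real (card {x \<in> periodic_points G n. drift n x \<ge> 0}) =
      (\<Sum>u\<in>verts G. \<Sum>t\<in>verts G.
        fps_nth (fps_X * fps_deriv (gen_fun (blocks G u t)) * gen_fun (up_words G t u)) n)"
    by (simp only: of_nat_sum
        card_marked_pairs(2)[OF finite_alphabet blocks_alphabet up_words_alphabet])
qed

text \<open>
  An arc that stays on the stack makes the drift positive; with drift zero the whole period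
  is a product of code words.
\<close>

lemma rooted_zero_drift_iff:
  assumes q: "(u, t, (b, w), j) \<in> rooted_points G n"
  shows "drift n (unroot (u, t, (b, w), j)) = 0 \<longleftrightarrow>
    t = u \<and> b \<in> markov_dyck_code G u \<and> w \<in> dyck_closed G u"
proof -
  note r = rooted_pointsD[OF q]
  have d: "drift n (unroot (u, t, (b, w), j)) = height b + height w"
    using height_subword_periodic[OF periodic_unroot[OF r(5)[symmetric], of u t j], of "- int j"]
      subword_unroot[OF r(5)[symmetric], of u t j] by simp
  obtain st where st: "run G w (t, []) = Some (u, st)" using r by (auto simp: up_words_def)
  have hw: "height w = int (length st)" using run_height[OF st] by simp
  have code: "height b = 0 \<and> t = u" if c: "b \<in> markov_dyck_code G u"
    using run_height[of G b u "[]" u "[]"] blocks_up[OF r(1,3)] c r(1)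
    by (auto simp: code_iff up_words_def)
  have "height b = 1" if "b \<notin> markov_dyck_code G u"
    using that r(3) by (auto simp: blocks_def split: if_splits)
  then show ?thesis
    using code st hw r(4) unfolding d
    by (cases "b \<in> markov_dyck_code G u") (auto simp: dyck_closed_def up_words_def)
qed

text \<open>
  The bijection \<open>unroot\<close> restricts to the points of drift zero.
\<close>

lemma card_zero_drift:
  assumes n: "n > 0"
  shows "real (card {x \<in> periodic_points G n. drift n x = 0}) =
    (\<Sum>u\<in>verts G.
      fps_nth (fps_X * fps_deriv (gen_fun (markov_dyck_code G u)) * gen_fun (dyck_closed G u)) n)"
proof -
  define Z where "Z = {q \<in> rooted_points G n. drift n (unroot q) = 0}"
  define M where "M = (SIGMA u:verts G. marked_pairs (markov_dyck_code G u) (dyck_closed G u) n)"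
  have "{x \<in> periodic_points G n. drift n x = 0} = {x \<in> unroot ` rooted_points G n. drift n x = 0}"
    unfolding unroot_image[OF n] by auto
  also have "\<dots> = unroot ` Z" by (auto simp: Z_def)
  finally have "card {x \<in> periodic_points G n. drift n x = 0} = card Z"
    using card_image[OF inj_on_subset[OF unroot_inj, of Z n]] by (simp add: Z_def)
  also have "Z = (\<lambda>(u, m). (u, u, m)) ` M"
  proof (intro Set.set_eqI iffI)
    fix q assume q: "q \<in> Z"
    obtain u t b w j where q1: "q = (u, t, (b, w), j)" by (metis surj_pair)
    have qr: "(u, t, (b, w), j) \<in> rooted_points G n" using q q1 by (simp add: Z_def)
    then have "t = u \<and> b \<in> markov_dyck_code G u \<and> w \<in> dyck_closed G u"
      using q q1 rooted_zero_drift_iff[OF qr] by (simp add: Z_def)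
    then have "(u, (b, w), j) \<in> M" "q = (\<lambda>(u, m). (u, u, m)) (u, (b, w), j)"
      using rooted_pointsD[OF qr] q1 by (auto simp: M_def marked_pairs_def)
    then show "q \<in> (\<lambda>(u, m). (u, u, m)) ` M" by blast
  next
    fix q assume "q \<in> (\<lambda>(u, m). (u, u, m)) ` M"
    then obtain u b w j where q1: "q = (u, u, (b, w), j)" and m: "u \<in> verts G"
      "((b, w), j) \<in> marked_pairs (markov_dyck_code G u) (dyck_closed G u) n"
      by (auto simp: M_def)
    have "(u, u, (b, w), j) \<in> rooted_points G n"
      using m code_blocks closed_up by (auto simp: rooted_points_def marked_pairs_def)
    then show "q \<in> Z"
      using rooted_zero_drift_iff[of u u b w j n] m q1 by (auto simp: Z_def marked_pairs_def)
  qed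
  also have "card ((\<lambda>(u, m). (u, u, m)) ` M) = card M"
    by (rule card_image) (auto simp: inj_on_def)
  also have "real (card M) = (\<Sum>u\<in>verts G.
      fps_nth (fps_X * fps_deriv (gen_fun (markov_dyck_code G u)) * gen_fun (dyck_closed G u)) n)"
  proof -
    have "card M = (\<Sum>u\<in>verts G. card (marked_pairs (markov_dyck_code G u) (dyck_closed G u) n))"
      unfolding M_def
      using card_marked_pairs(1)[OF finite_alphabet code_alphabet dyck_closed_alphabet] by simp
    then show ?thesis
      by (simp only: of_nat_sum
        card_marked_pairs(2)[OF finite_alphabet code_alphabet dyck_closed_alphabet])
  qed
  finally show ?thesis .
qed

end

section \<open>Reversal\<close>

lemma gen_star_involution [simp]: "gen_star (gen_star x) = x"
  by (cases x) auto

lemma letter_height_star [simp]: "letter_height (gen_star x) = - letter_height x"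
  by (cases x) auto

lemma height_rev_star: "height (rev (map gen_star w)) = - height w"
  by (induction w) auto

lemma step_star: "step G x s = Some s' \<Longrightarrow> step G (gen_star x) s' = Some s"
  by (cases "(G, x, s)" rule: step.cases) (auto split: if_splits)

text \<open>
  The involution \<open>gen_star\<close> inverts the action of each letter, and the action is by partial
  injections.
\<close>

lemma run_rev_star: "run G w s = Some s' \<Longrightarrow> run G (rev (map gen_star w)) s' = Some s"
proof (induction w arbitrary: s)
  case (Cons x w)
  then obtain s1 where 1: "step G x s = Some s1" "run G w s1 = Some s'"
    by (auto simp: bind_eq_Some_conv)
  show ?case using Cons.IH[OF 1(2)] step_star[OF 1(1)] by (simp add: run_append)
qed simp

definition reversal :: "(int \<Rightarrow> ('v, 'e) gen) \<Rightarrow> int \<Rightarrow> ('v, 'e) gen" where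
  "reversal x = (\<lambda>i. gen_star (x (- i)))"

lemma reversal_involution [simp]: "reversal (reversal x) = x"
  by (simp add: reversal_def)

lemma subword_reversal:
  "subword (reversal x) i m = rev (map gen_star (subword x (1 - i - int m) m))"
proof (rule nth_equalityI)
  fix k assume "k < length (subword (reversal x) i m)"
  then have k: "k < m" by simp
  have "rev (map gen_star (subword x (1 - i - int m) m)) ! k =
      gen_star (x (1 - i - int m + int (m - Suc k)))"
    using k by (simp add: rev_nth nth_subword)
  also have "1 - i - int m + int (m - Suc k) = - (i + int k)"
    using k by (simp add: of_nat_diff)
  finally show "subword (reversal x) i m ! k = rev (map gen_star (subword x (1 - i - int m) m)) ! k"
    using k by (simp add: nth_subword reversal_def)
qed simp

lemma periodic_reversal: "periodic n x \<Longrightarrow> periodic n (reversal x)"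
proof -
  assume p: "periodic n x"
  show "periodic n (reversal x)"
    using periodic_add_mult[OF p, of _ "- 1"] by (simp add: periodic_def reversal_def)
qed

lemma drift_reversal: "periodic n x \<Longrightarrow> drift n (reversal x) = - drift n x"
  unfolding drift_def[of n "reversal x"] subword_reversal height_rev_star
  by (simp add: height_subword_periodic)

context wf_digraph
begin

lemma reversal_in_shift:
  assumes "x \<in> markov_dyck_shift G"
  shows "reversal x \<in> markov_dyck_shift G"
  unfolding markov_dyck_shift_iff
proof (intro conjI allI)
  fix i show "reversal x i \<in> alphabet G"
    using assms by (simp add: markov_dyck_shift_iff reversal_def gen_star_alphabet)
next
  fix i m
  obtain s s' where "run G (subword x (1 - i - int m) m) s = Some s'"
    using assms unfolding markov_dyck_shift_iff by (metis not_None_eq)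
  from run_rev_star[OF this] show "\<exists>s. run G (subword (reversal x) i m) s \<noteq> None"
    unfolding subword_reversal by (metis option.distinct(1))
qed

lemma reversal_periodic_points: "x \<in> periodic_points G n \<Longrightarrow> reversal x \<in> periodic_points G n"
  by (simp add: periodic_points_def reversal_in_shift periodic_reversal)

lemma bij_betw_reversal:
  "bij_betw reversal {x \<in> periodic_points G n. drift n x > 0} {x \<in> periodic_points G n. drift n x < 0}"
  by (rule bij_betw_byWitness[where f' = reversal])
    (auto simp: reversal_periodic_points drift_reversal periodic_points_def reversal_in_shift periodic_reversal)

end

context fin_digraph
begin

text \<open>
  By reversal the points of negative drift are as many as those of positive drift.
\<close>

lemma card_periodic_points:
  assumes n: "n > 0"
  shows "real (card (periodic_points G n)) =
    2 * real (card {x \<in> periodic_points G n. drift n x \<ge> 0}) -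
    real (card {x \<in> periodic_points G n. drift n x = 0})"
proof -
  define P where "P = {x \<in> periodic_points G n. drift n x > 0}"
  define Z where "Z = {x \<in> periodic_points G n. drift n x = 0}"
  define N where "N = {x \<in> periodic_points G n. drift n x < 0}"
  have NN: "{x \<in> periodic_points G n. drift n x \<ge> 0} = P \<union> Z" by (auto simp: P_def Z_def)
  have f: "finite P" "finite Z"
    using card_nonneg_drift(1)[OF n] unfolding NN by auto
  have "card N = card P" "finite N"
    using bij_betw_same_card[OF bij_betw_reversal] bij_betw_finite[OF bij_betw_reversal] f
    by (auto simp: P_def N_def)
  moreover have "periodic_points G n = (P \<union> Z) \<union> N" by (auto simp: P_def Z_def N_def)
  moreover have "P \<inter> Z = {}" "(P \<union> Z) \<inter> N = {}" by (auto simp: P_def Z_def N_def)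
  ultimately show ?thesis
    unfolding NN Z_def[symmetric] using f by (simp add: card_Un_disjoint)
qed

end

section \<open>Logarithmic derivatives of determinants and of zeta functions\<close>

text \<open>
  The product rule, with all products over the full index set, as in the Leibniz expansion of a
  determinant.
\<close>

lemma fps_deriv_prod:
  fixes f :: "'i \<Rightarrow> 'a :: comm_ring_1 fps"
  assumes "finite A"
  shows "fps_deriv (prod f A) = (\<Sum>k\<in>A. \<Prod>i\<in>A. if i = k then fps_deriv (f i) else f i)"
  using assms
proof (induction A rule: finite_induct)
  case (insert x A)
  have "(\<Prod>i\<in>A. if i = x then fps_deriv (f i) else f i) = prod f A"
    by (rule prod.cong) (use insert in auto)
  moreover have "(\<Sum>k\<in>A. \<Prod>i\<in>insert x A. if i = k then fps_deriv (f i) else f i) =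
      f x * (\<Sum>k\<in>A. \<Prod>i\<in>A. if i = k then fps_deriv (f i) else f i)"
    unfolding sum_distrib_left by (rule sum.cong) (use insert in auto)
  ultimately show ?case using insert by simp
qed auto

text \<open>
  Jacobi's formula: differentiating one row at a time in the Leibniz expansion gives determinants
  in which this row is replaced by its derivative, and these are expanded along that row.
\<close>

lemma fps_deriv_det:
  fixes A :: "'a :: comm_ring_1 fps mat"
  assumes A: "A \<in> carrier_mat n n"
  shows "fps_deriv (det A) = (\<Sum>i<n. \<Sum>j<n. fps_deriv (A $$ (i, j)) * cofactor A i j)"
proof -
  define B where "B k = mat n n (\<lambda>(i, j). if i = k then fps_deriv (A $$ (i, j)) else A $$ (i, j))" for k
  have B: "B k \<in> carrier_mat n n" for k by (simp add: B_def)
  have pm: "p i < n" if "p permutes {0..<n}" "i < n" for p i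
    using permutes_in_image[OF that(1), of i] that by simp
  have sg: "fps_deriv (signof p * F) = signof p * fps_deriv F" for p :: "nat \<Rightarrow> nat" and F :: "'a fps"
    by (simp add: sign_def)
  have "fps_deriv (det A) =
      (\<Sum>p | p permutes {0..<n}. signof p * (\<Sum>k = 0..<n. \<Prod>i = 0..<n. B k $$ (i, p i)))"
    unfolding det_def'[OF A] fps_deriv_sum sg fps_deriv_prod[OF finite_atLeastLessThan]
    by (intro sum.cong prod.cong arg_cong2[of _ _ _ _ times] HOL.refl)
      (auto simp: B_def pm)
  also have "\<dots> = (\<Sum>k = 0..<n. det (B k))"
    unfolding det_def'[OF B] sum_distrib_left by (rule sum.swap)
  also have "\<dots> = (\<Sum>k<n. \<Sum>j<n. fps_deriv (A $$ (k, j)) * cofactor A k j)"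
    unfolding atLeast0LessThan
  proof (rule sum.cong[OF HOL.refl])
    fix k assume k: "k \<in> {..<n}"
    have "mat_delete (B k) k j = mat_delete A k j" if "j < n" for j
      using A k that by (intro eq_matI) (auto simp: B_def mat_delete_def)
    then show "det (B k) = (\<Sum>j<n. fps_deriv (A $$ (k, j)) * cofactor A k j)"
      using k unfolding laplace_expansion_row[OF B, of k k]
      by (subst laplace_expansion_row[OF B, of k]) (auto simp: B_def cofactor_def intro!: sum.cong)
  qed
  finally show ?thesis .
qed

lemma cofactor_eq_det_mult_inverse:
  assumes A: "A \<in> carrier_mat n n" and S: "S \<in> carrier_mat n n" and AS: "A * S = 1\<^sub>m n"
    and ij: "i < n" "j < n"
  shows "cofactor A i j = det A * S $$ (j, i)"
proof -
  note adj = adj_mat[OF A]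
  have "adj_mat A = adj_mat A * (A * S)" using adj(1) AS by simp
  also have "\<dots> = (adj_mat A * A) * S" using assoc_mult_mat[OF adj(1) A S] by simp
  also have "\<dots> = det A \<cdot>\<^sub>m S" using adj(3) mult_smult_assoc_mat[OF one_carrier_mat S] S by simp
  finally have "adj_mat A $$ (j, i) = det A * S $$ (j, i)" using S ij by simp
  then show ?thesis using A ij by (simp add: adj_mat_def)
qed

text \<open>
  The cofactors of \<open>1 - H\<close> are the entries of \<open>det (1 - H) S\<close>, so Jacobi's formula turns into a trace.
\<close>

lemma log_deriv_det:
  fixes H :: "'a :: comm_ring_1 fps mat"
  assumes H: "H \<in> carrier_mat n n" and S: "S \<in> carrier_mat n n" and inv: "(1\<^sub>m n - H) * S = 1\<^sub>m n"
  shows "fps_X * fps_deriv (det (1\<^sub>m n - H)) =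
    - det (1\<^sub>m n - H) * (\<Sum>i<n. \<Sum>j<n. fps_X * fps_deriv (H $$ (i, j)) * S $$ (j, i))"
proof -
  have c: "1\<^sub>m n - H \<in> carrier_mat n n" by (rule minus_carrier_mat[OF H])
  have "fps_deriv ((1\<^sub>m n - H) $$ (i, j)) * cofactor (1\<^sub>m n - H) i j =
      - det (1\<^sub>m n - H) * (fps_deriv (H $$ (i, j)) * S $$ (j, i))" if "i < n" "j < n" for i j
    using that H cofactor_eq_det_mult_inverse[OF c S inv that] by simp
  then have "fps_deriv (det (1\<^sub>m n - H)) =
      (\<Sum>i<n. \<Sum>j<n. - det (1\<^sub>m n - H) * (fps_deriv (H $$ (i, j)) * S $$ (j, i)))"
    unfolding fps_deriv_det[OF c] by (intro sum.cong HOL.refl) auto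
  then show ?thesis by (simp add: sum_distrib_left mult_ac sum_negf)
qed

text \<open>
  Taking the constant coefficient is a ring homomorphism, so it commutes with the determinant.
\<close>

lemma det_one_minus_nth_0:
  fixes H :: "real fps mat"
  assumes H: "H \<in> carrier_mat n n" and z: "\<And>i j. i < n \<Longrightarrow> j < n \<Longrightarrow> fps_nth (H $$ (i, j)) 0 = 0"
  shows "fps_nth (det (1\<^sub>m n - H)) 0 = 1"
proof -
  interpret h: comm_ring_hom "\<lambda>f :: real fps. fps_nth f 0" by standard auto
  have "map_mat (\<lambda>f. fps_nth f 0) (1\<^sub>m n - H) = 1\<^sub>m n"
    using H z by (intro eq_matI) auto
  then show ?thesis using h.hom_det[of "1\<^sub>m n - H"] by simp
qed

text \<open>
  The quotient of \<open>f\<close> and \<open>g\<close> has derivative zero.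
\<close>

lemma fps_log_deriv_unique:
  fixes f g P :: "real fps"
  assumes f: "fps_X * fps_deriv f = f * P" and g: "fps_X * fps_deriv g = g * P"
    and 0: "fps_nth f 0 = fps_nth g 0" "fps_nth g 0 \<noteq> 0"
  shows "f = g"
proof -
  have "fps_X * (fps_deriv f * g - f * fps_deriv g) = (fps_X * fps_deriv f) * g - f * (fps_X * fps_deriv g)"
    by (simp add: algebra_simps)
  also have "\<dots> = 0" unfolding f g by simp
  finally have *: "fps_deriv f * g = f * fps_deriv g" by simp
  have gi: "g * inverse g = 1" using 0 by (simp add: inverse_mult_eq_1')
  have "fps_deriv (f * inverse g) = (fps_deriv f * g - f * fps_deriv g) * (inverse g)\<^sup>2"
    using 0 gi by (simp add: fps_inverse_deriv power2_eq_square algebra_simps)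
  then have "fps_deriv (f * inverse g) = 0" unfolding * by simp
  then have "f * inverse g = fps_const (fps_nth (f * inverse g) 0)" by (rule fps_deriv_eq_0_iff[THEN iffD1])
  also have "fps_nth (f * inverse g) 0 = 1" using 0 by simp
  finally have "f * inverse g = 1" by simp
  then have "f * (g * inverse g) = g" by (metis mult.commute mult.left_commute mult_1)
  then show ?thesis using gi by simp
qed

definition period_series :: "(int \<Rightarrow> 'a) set \<Rightarrow> real fps" where
  "period_series X = Abs_fps (\<lambda>n. if n = 0 then 0 else of_nat (num_periodic X n))"

lemma zeta_nth_0: "fps_nth (zeta X) 0 = 1"
  by (simp add: zeta_def)

lemma zeta_log_deriv: "fps_X * fps_deriv (zeta X) = zeta X * period_series X"
proof -
  define L :: "real fps" where "L = Abs_fps (\<lambda>n. if n = 0 then 0 else of_nat (num_periodic X n) / of_nat n)"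
  have "fps_deriv (zeta X) = zeta X * fps_deriv L"
    unfolding zeta_def L_def[symmetric] using fps_compose_deriv[of L "fps_exp 1"] by (simp add: L_def)
  moreover have "fps_X * fps_deriv L = period_series X"
    by (rule fps_ext) (auto simp: L_def period_series_def)
  ultimately show ?thesis by (metis mult.left_commute)
qed

text \<open>
  Both $\zeta \det(1 - H)^2$ and $\det(1 - D)$, where \<open>H = D + B\<close>, have the logarithmic derivative
  $-\mathrm{tr}(z D' D^*)$, so they are equal.  Writing \<open>d\<close>, \<open>h\<close>, \<open>k\<close> for the determinants of
  \<open>1 - D\<close>, \<open>1 - H\<close> and \<open>1 - Ds * B\<close>, the factorization of \<open>1 - H\<close> gives \<open>h = d * k\<close>, and the two
  quotients follow by cancellation.
\<close>

lemma zeta_eq_det_quotients: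
  fixes D Ds B S :: "real fps mat"
  assumes carr: "D \<in> carrier_mat n n" "Ds \<in> carrier_mat n n" "B \<in> carrier_mat n n" "S \<in> carrier_mat n n"
    and z: "\<And>i j. i < n \<Longrightarrow> j < n \<Longrightarrow> fps_nth (D $$ (i, j)) 0 = 0" "\<And>i j. i < n \<Longrightarrow> j < n \<Longrightarrow> fps_nth (B $$ (i, j)) 0 = 0"
    and Ds: "(1\<^sub>m n - D) * Ds = 1\<^sub>m n" and S: "(1\<^sub>m n - (D + B)) * S = 1\<^sub>m n"
    and P: "period_series X =
      2 * (\<Sum>i<n. \<Sum>j<n. fps_X * fps_deriv ((D + B) $$ (i, j)) * S $$ (j, i)) -
      (\<Sum>i<n. \<Sum>j<n. fps_X * fps_deriv (D $$ (i, j)) * Ds $$ (j, i))"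
  shows "zeta X = 1 / det ((1\<^sub>m n - D - B) * (1\<^sub>m n - Ds * B))"
    and "zeta X = det Ds / (det (1\<^sub>m n - Ds * B)) ^ 2"
proof -
  define d where "d = det (1\<^sub>m n - D)"
  define h where "h = det (1\<^sub>m n - (D + B))"
  define k where "k = det (1\<^sub>m n - Ds * B)"
  have c: "1\<^sub>m n - D \<in> carrier_mat n n" "D + B \<in> carrier_mat n n" "1\<^sub>m n - Ds * B \<in> carrier_mat n n"
    "Ds * B \<in> carrier_mat n n" "1\<^sub>m n - D - B \<in> carrier_mat n n"
    using carr by auto
  have mat_eq: "1\<^sub>m n - D - B = 1\<^sub>m n - (D + B)"
    by (rule eq_matI) (use carr in auto)
  have fact: "(1\<^sub>m n - D) * (1\<^sub>m n - Ds * B) = 1\<^sub>m n - D - B"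
  proof -
    have "(1\<^sub>m n - D) * (1\<^sub>m n - Ds * B) = (1\<^sub>m n - D) * 1\<^sub>m n - (1\<^sub>m n - D) * (Ds * B)"
      by (rule mult_minus_distrib_mat[OF c(1) _ c(4)]) simp
    also have "(1\<^sub>m n - D) * (Ds * B) = B"
      using assoc_mult_mat[OF c(1) carr(2,3)] Ds carr by simp
    finally show ?thesis by (simp only: right_mult_one_mat[OF c(1)])
  qed
  have dk: "d * k = h"
    using det_mult[OF c(1,3)] fact mat_eq by (simp add: d_def k_def h_def)
  have dDs: "d * det Ds = 1"
    using det_mult[OF c(1) carr(2)] Ds by (simp add: d_def)
  have d0: "fps_nth d 0 = 1" unfolding d_def by (rule det_one_minus_nth_0[OF carr(1) z(1)])
  have h0: "fps_nth h 0 = 1" unfolding h_def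
    by (rule det_one_minus_nth_0[OF c(2)]) (use z carr in auto)
  have "fps_X * fps_deriv (zeta X * h\<^sup>2) =
      (fps_X * fps_deriv (zeta X)) * h\<^sup>2 + 2 * zeta X * h * (fps_X * fps_deriv h)"
    by (simp add: power2_eq_square algebra_simps)
  also have "\<dots> = zeta X * h\<^sup>2 *
      - (\<Sum>i<n. \<Sum>j<n. fps_X * fps_deriv (D $$ (i, j)) * Ds $$ (j, i))"
    unfolding zeta_log_deriv P h_def log_deriv_det[OF c(2) carr(4) S]
    by (simp add: power2_eq_square algebra_simps)
  finally have "zeta X * h\<^sup>2 = d"
    by (rule fps_log_deriv_unique)
      (use log_deriv_det[OF carr(1,2) Ds] d0 h0 in \<open>auto simp: d_def zeta_nth_0 fps_power_zeroth\<close>)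
  then have "d * (zeta X * (h * k)) = d * 1"
    using dk by (metis mult.assoc mult.commute mult.right_neutral power2_eq_square)
  moreover have dn: "d \<noteq> 0" using d0 by auto
  ultimately have kh: "zeta X * (h * k) = 1" by (auto simp only: mult_cancel_left)
  then have hk0: "h * k \<noteq> 0" by auto
  have "det ((1\<^sub>m n - D - B) * (1\<^sub>m n - Ds * B)) = h * k"
    using det_mult[OF c(5,3)] mat_eq by (simp add: h_def k_def)
  moreover have "zeta X * (h * k) / (h * k) = zeta X"
    using hk0 by (rule nonzero_mult_div_cancel_right)
  ultimately show "zeta X = 1 / det ((1\<^sub>m n - D - B) * (1\<^sub>m n - Ds * B))" using kh by simp
  have "d * (zeta X * k\<^sup>2) = d * det Ds"
    using kh dk[symmetric] dDs by (simp add: power2_eq_square mult_ac)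
  then have "zeta X * k\<^sup>2 = det Ds" using dn by simp
  moreover have "zeta X * k\<^sup>2 / k\<^sup>2 = zeta X"
    using hk0 by (intro nonzero_mult_div_cancel_right) auto
  ultimately show "zeta X = det Ds / (det (1\<^sub>m n - Ds * B)) ^ 2" by (simp add: k_def)
qed

section \<open>The zeta function of the Markov-Dyck shift\<close>

lemma (in fin_digraph) period_series_markov_dyck_shift:
  "period_series (markov_dyck_shift G) =
    2 * (\<Sum>u\<in>verts G. \<Sum>t\<in>verts G.
      fps_X * fps_deriv (gen_fun (blocks G u t)) * gen_fun (up_words G t u)) -
    (\<Sum>u\<in>verts G. fps_X * fps_deriv (gen_fun (markov_dyck_code G u)) * gen_fun (dyck_closed G u))"
  (is "_ = 2 * ?A - ?B")
proof (rule fps_ext)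
  fix n
  have c: "fps_nth (2 * ?A - ?B) n = 2 * fps_nth ?A n - fps_nth ?B n"
    by (simp only: mult_2 fps_add_nth fps_sub_nth)
  show "fps_nth (period_series (markov_dyck_shift G)) n = fps_nth (2 * ?A - ?B) n"
  proof (cases "n = 0")
    case True
    then show ?thesis unfolding c by (simp add: period_series_def fps_sum_nth)
  next
    case False
    then have n: "n > 0" by simp
    have "fps_nth (period_series (markov_dyck_shift G)) n = real (card (periodic_points G n))"
      using n by (simp add: period_series_def num_periodic_eq)
    then show ?thesis
      unfolding c fps_sum_nth card_periodic_points[OF n] card_nonneg_drift(2)[OF n]
        card_zero_drift[OF n] .
  qed
qed

theorem theorem2p3:
  fixes G :: "('v, 'e) pre_digraph" and vs :: "'v list"
  assumes "fin_digraph G"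
    and "distinct vs" and "set vs = verts G"
  shows "zeta (markov_dyck_shift G) =
      1 / det ((1\<^sub>m (length vs) - code_mat G vs - fps_X \<cdot>\<^sub>m adjacency_mat G vs) *
               (1\<^sub>m (length vs) - code_star_mat G vs * (fps_X \<cdot>\<^sub>m adjacency_mat G vs))) \<and>
    1 / det ((1\<^sub>m (length vs) - code_mat G vs - fps_X \<cdot>\<^sub>m adjacency_mat G vs) *
               (1\<^sub>m (length vs) - code_star_mat G vs * (fps_X \<cdot>\<^sub>m adjacency_mat G vs))) =
      det (code_star_mat G vs) /
        (det (1\<^sub>m (length vs) - code_star_mat G vs * (fps_X \<cdot>\<^sub>m adjacency_mat G vs))) ^ 2"
proof -
  interpret fin_digraph G by (rule assms(1))
  define n where "n = length vs"
  define D where "D = code_mat G vs"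
  define Ds where "Ds = code_star_mat G vs"
  define B where "B = fps_X \<cdot>\<^sub>m adjacency_mat G vs"
  define S where "S = mat n n (\<lambda>(i, j). gen_fun (up_words G (vs ! i) (vs ! j)))"
  define a where "a i = gen_fun (markov_dyck_code G (vs ! i))" for i
  define c where "c i = gen_fun (dyck_closed G (vs ! i))" for i
  have vert: "vs ! i \<in> verts G" if "i < n" for i
    using that assms(3) nth_mem[of i vs] by (simp add: n_def)
  have idx: "vs ! i = vs ! j \<longleftrightarrow> i = j" if "i < n" "j < n" for i j
    using that nth_eq_iff_index_eq[OF assms(2)] by (simp add: n_def)
  have sum_verts: "(\<Sum>v\<in>verts G. f v) = (\<Sum>i<n. f (vs ! i))" for f :: "'v \<Rightarrow> real fps"
    using sum.reindex_bij_betw[OF bij_betw_nth[OF assms(2) HOL.refl HOL.refl], of f] assms(3)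
    by (simp add: n_def)
  have carr: "D \<in> carrier_mat n n" "Ds \<in> carrier_mat n n" "B \<in> carrier_mat n n" "S \<in> carrier_mat n n"
    by (simp_all add: D_def Ds_def B_def S_def n_def code_mat_def code_star_mat_def adjacency_mat_def)
  have ac: "(1 - a i) * c i = 1" if "i < n" for i
    using gen_fun_dyck_closed[OF vert[OF that]] by (simp add: a_def c_def algebra_simps)
  have D_nth: "D $$ (i, j) = (if i = j then a i else 0)" if "i < n" "j < n" for i j
    using that by (simp add: D_def code_mat_def mat_diag_def n_def a_def)
  have Ds_nth: "Ds $$ (i, j) = (if i = j then c i else 0)" if "i < n" "j < n" for i j
  proof -
    have "c i * (1 - a i) / (1 - a i) = c i"
      by (rule nonzero_mult_div_cancel_right) (use ac[OF that(1)] in auto)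
    moreover have "c i * (1 - a i) = 1" using ac[OF that(1)] by (simp only: mult.commute)
    ultimately have "1 / (1 - a i) = c i" by (simp only:)
    then show ?thesis
      using that by (auto simp add: Ds_def code_star_mat_def mat_diag_def n_def a_def)
  qed
  have H_nth: "(D + B) $$ (i, j) = gen_fun (blocks G (vs ! i) (vs ! j))" if "i < n" "j < n" for i j
  proof -
    have "B $$ (i, j) = fps_X * of_nat (card {e \<in> arcs G. tail G e = vs ! i \<and> head G e = vs ! j})"
      using that by (simp add: B_def adjacency_mat_def n_def)
    then show ?thesis
      using that carr D_nth idx gen_fun_blocks[OF vert, of i "vs ! j"] by (auto simp: a_def)
  qed
  have a0: "fps_nth (a i) 0 = 0" for i
    unfolding a_def by (rule gen_fun_nth_0) (simp add: markov_dyck_code_def)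
  have z: "fps_nth (D $$ (i, j)) 0 = 0" "fps_nth (B $$ (i, j)) 0 = 0" if "i < n" "j < n" for i j
    using that a0 D_nth by (auto simp: B_def adjacency_mat_def n_def)
  have Ds_inv: "(1\<^sub>m n - D) * Ds = 1\<^sub>m n"
  proof (rule eq_matI)
    fix i j assume "i < dim_row (1\<^sub>m n :: real fps mat)" "j < dim_col (1\<^sub>m n :: real fps mat)"
    then have ij: "i < n" "j < n" by auto
    have "((1\<^sub>m n - D) * Ds) $$ (i, j) = (\<Sum>k\<in>{0..<n}. (1\<^sub>m n - D) $$ (i, k) * Ds $$ (k, j))"
      using ij carr by (simp add: scalar_prod_def)
    also have "\<dots> = (\<Sum>k\<in>{0..<n}. if k = i then (if i = j then 1 else 0) else 0)"
      by (rule sum.cong) (use ij carr ac in \<open>auto simp: D_nth Ds_nth\<close>)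
    also have "\<dots> = 1\<^sub>m n $$ (i, j)" using ij by simp
    finally show "((1\<^sub>m n - D) * Ds) $$ (i, j) = 1\<^sub>m n $$ (i, j)" .
  qed (use carr in auto)
  have S_inv: "(1\<^sub>m n - (D + B)) * S = 1\<^sub>m n"
  proof (rule eq_matI)
    fix i j assume "i < dim_row (1\<^sub>m n :: real fps mat)" "j < dim_col (1\<^sub>m n :: real fps mat)"
    then have ij: "i < n" "j < n" by auto
    have "((1\<^sub>m n - (D + B)) * S) $$ (i, j) = (\<Sum>k<n. (1\<^sub>m n - (D + B)) $$ (i, k) * S $$ (k, j))"
      using ij carr by (simp add: scalar_prod_def atLeast0LessThan)
    also have "\<dots> = (\<Sum>k<n. (if k = i then S $$ (i, j) else 0) -
        gen_fun (blocks G (vs ! i) (vs ! k)) * gen_fun (up_words G (vs ! k) (vs ! j)))"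
    proof (rule sum.cong[OF HOL.refl])
      fix k assume "k \<in> {..<n}"
      then have k: "k < n" by simp
      have e: "(1\<^sub>m n - (D + B)) $$ (i, k) = (if k = i then 1 else 0) - gen_fun (blocks G (vs ! i) (vs ! k))"
        using ij k carr H_nth[OF ij(1) k] by auto
      then show "(1\<^sub>m n - (D + B)) $$ (i, k) * S $$ (k, j) = (if k = i then S $$ (i, j) else 0) -
          gen_fun (blocks G (vs ! i) (vs ! k)) * gen_fun (up_words G (vs ! k) (vs ! j))"
        unfolding e using ij k by (auto simp: S_def algebra_simps)
    qed
    also have "\<dots> = S $$ (i, j) -
        (\<Sum>k<n. gen_fun (blocks G (vs ! i) (vs ! k)) * gen_fun (up_words G (vs ! k) (vs ! j)))"
      using ij by (simp add: sum_subtractf)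
    also have "\<dots> = 1\<^sub>m n $$ (i, j)"
      using gen_fun_up_words[OF vert[OF ij(1)], of "vs ! j"] idx[OF ij] ij by (simp add: S_def sum_verts)
    finally show "((1\<^sub>m n - (D + B)) * S) $$ (i, j) = 1\<^sub>m n $$ (i, j)" .
  qed (use carr in auto)
  have P: "period_series (markov_dyck_shift G) =
      2 * (\<Sum>i<n. \<Sum>j<n. fps_X * fps_deriv ((D + B) $$ (i, j)) * S $$ (j, i)) -
      (\<Sum>i<n. \<Sum>j<n. fps_X * fps_deriv (D $$ (i, j)) * Ds $$ (j, i))"
  proof -
    have "(\<Sum>i<n. \<Sum>j<n. fps_X * fps_deriv ((D + B) $$ (i, j)) * S $$ (j, i)) =
        (\<Sum>i<n. \<Sum>j<n. fps_X * fps_deriv (gen_fun (blocks G (vs ! i) (vs ! j))) *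
          gen_fun (up_words G (vs ! j) (vs ! i)))"
      by (intro sum.cong HOL.refl) (simp add: H_nth S_def del: index_add_mat)
    moreover have "(\<Sum>i<n. \<Sum>j<n. fps_X * fps_deriv (D $$ (i, j)) * Ds $$ (j, i)) =
        (\<Sum>i<n. fps_X * fps_deriv (a i) * c i)"
    proof (rule sum.cong[OF HOL.refl])
      fix i assume "i \<in> {..<n}"
      then have i: "i < n" by simp
      have "(\<Sum>j<n. fps_X * fps_deriv (D $$ (i, j)) * Ds $$ (j, i)) =
          (\<Sum>j<n. if j = i then fps_X * fps_deriv (a i) * c i else 0)"
        by (rule sum.cong) (use i in \<open>auto simp: D_nth Ds_nth\<close>)
      then show "(\<Sum>j<n. fps_X * fps_deriv (D $$ (i, j)) * Ds $$ (j, i)) = fps_X * fps_deriv (a i) * c i"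
        using i by simp
    qed
    ultimately show ?thesis
      unfolding period_series_markov_dyck_shift sum_verts by (simp only: a_def c_def)
  qed
  note zeta = zeta_eq_det_quotients[OF carr z Ds_inv S_inv P]
  show ?thesis
    unfolding n_def[symmetric] D_def[symmetric] Ds_def[symmetric] B_def[symmetric]
    using zeta by simp
qed

end
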